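(* For every $C>0$ and $0\le\rho<1$, there exist $\alpha,\beta,\gamma>0$ and $n_1\in\mathbb N$ such that, for every integer $n\ge n_1$ and every fixed $x\in[-1,1]^n$, independent uniform random signs $Y=(Y_1,\ldots,Y_n)\in\{-1,1\}^n$ satisfy $$\mathbb P\left\{E_\rho(P;x,Y)>\beta n\ \text{ for every }P\in\mathcal P_{(1+\alpha)n}(C)\right\}\ge1-e^{-\gamma n}.$$
   Context: $\mathbb N=\{1,2,\ldots\}$. For a polynomial $P$ put $\|P\|_{[-1,1]}=\max_{-1\le t\le1}|P(t)|$. Node vectors may have repeated entries; counts refer to indices. For $x,y\in[-1,1]^n$ and $\rho\ge0$, $E_\rho(P;x,y):=\#\{i\in\{1,\dots,n\}:|P(x_i)-y_i|>\rho\}$. For real $D\ge0$ and $C>0$, $\mathcal P_D(C):=\{P\in\mathbb C[X]:\deg P\le D,\ \|P\|_{[-1,1]}\le C\}$, with $\deg0=-\infty$. The constants $\alpha,\beta,\gamma,n_1$ depend only on $C$ and $\rho$. *)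

theory Defs
  imports
    "HOL-Probability.Probability"
    "HOL-Probability.Product_PMF"
    "HOL-Computational_Algebra.Polynomial"
begin

definition norm_Icc :: "complex poly \<Rightarrow> real" where
  "norm_Icc P = (SUP t\<in>{-1..1::real}. cmod (poly P (complex_of_real t)))"

text \<open>The supremum is a maximum:\<close>

lemma norm_Icc_attained:
  "\<exists>t\<in>{-1..1::real}. norm_Icc P = cmod (poly P (complex_of_real t)) \<and>
     (\<forall>s\<in>{-1..1}. cmod (poly P (complex_of_real s)) \<le> cmod (poly P (complex_of_real t)))"
proof -
  have "continuous_on {-1..1::real} (\<lambda>t. cmod (poly P (complex_of_real t)))"
    by (intro continuous_intros)
  then obtain t where t: "t \<in> {-1..1::real}"
    "\<forall>s\<in>{-1..1}. cmod (poly P (complex_of_real s)) \<le> cmod (poly P (complex_of_real t))"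
    using continuous_attains_sup[of "{-1..1::real}" "\<lambda>t. cmod (poly P (complex_of_real t))"]
    by auto
  have "norm_Icc P = cmod (poly P (complex_of_real t))"
    unfolding norm_Icc_def using t by (intro cSup_eq_maximum) auto
  with t show ?thesis by blast
qed

text \<open>Vectors of length \<open>n\<close> are functions on \<open>nat\<close> of which only the values at
  \<open>1, \<dots>, n\<close> are used.\<close>

definition err_count :: "real \<Rightarrow> nat \<Rightarrow> complex poly \<Rightarrow> (nat \<Rightarrow> real) \<Rightarrow> (nat \<Rightarrow> real) \<Rightarrow> nat" where
  "err_count \<rho> n P x y =
     card {i \<in> {1..n}. cmod (poly P (complex_of_real (x i)) - complex_of_real (y i)) > \<rho>}"

text \<open>The disjunct \<open>P = 0\<close> is the convention that the zero polynomial has degree \<open>-\<infinity>\<close>.\<close>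

definition bounded_polys :: "real \<Rightarrow> real \<Rightarrow> complex poly set" where
  "bounded_polys D C = {P. (P = 0 \<or> real (degree P) \<le> D) \<and> norm_Icc P \<le> C}"

text \<open>The law of \<open>n\<close> independent uniform signs with indices \<open>1, \<dots>, n\<close>; entries at all
  other indices are the irrelevant default value \<open>0\<close>.\<close>

definition random_signs :: "nat \<Rightarrow> (nat \<Rightarrow> real) pmf" where
  "random_signs n = Pi_pmf {1..n} 0 (\<lambda>_. pmf_of_set {-1, 1})"

end

theory Submission
  imports Defs "HOL-Complex_Analysis.Complex_Analysis"
begin

text \<open>
  Call a set \<open>\<Lambda>\<close> of \<open>m\<close> nodes interpolable if every sign pattern on it is the sign
  pattern of a polynomial of degree at most \<open>N\<close> bounded by \<open>K\<close> on \<open>[-1, 1]\<close> and of modulus at least 1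
  on \<open>\<Lambda>\<close>. The core is that \<open>m < (1 - \<delta>(K)) N\<close> for large \<open>N\<close>. To see this, let \<open>J\<close> be a
  Fejer-type kernel of degree about \<open>\<delta>N\<close>, and add about \<open>\<delta>N\<close> Fekete-type nodes \<open>A\<close> to \<open>\<Lambda>\<close>,
  so that \<open>X = \<Lambda> \<union> A\<close> determines the polynomials of degree \<open>N + deg J\<close> and the Lagrange polynomials
  of the added nodes are bounded by 2. Differentiating the Lagrange formula of \<open>P J(\<cdot> - k)\<close> at a node
  \<open>k\<close>, where \<open>P\<close> has the signs of the numbers \<open>l\<^sub>j'(k)\<close>, bounds \<open>\<Sum>j. J(j - k) \<bar>l\<^sub>j'(k)\<bar>\<close> by
  Bernstein's inequality. Summed over \<open>k\<close> the bound is \<open>O(N\<^sup>2)\<close>, uniformly in \<open>\<delta>\<close>. On the other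
  hand \<open>\<bar>l\<^sub>j'(k) l\<^sub>k'(j)\<bar> = 1 / (j - k)\<^sup>2\<close>, so that the double sum is at least a constant times the
  sum of \<open>1 / \<bar>j - k\<bar>\<close> over pairs at distance at most \<open>1 / (\<delta>N)\<close>, which is of order \<open>N\<^sup>2 log (1 / \<delta>)\<close>.

  Gluing interpolants with the same kernel, the obstruction becomes local: any \<open>(1 - \<delta>)n\<close> nodes
  contain a block of at most \<open>b = O(1)\<close> nodes with a sign pattern that no admissible polynomial
  approximates on the block. Hence there are linearly many disjoint such blocks, and with
  probability exponentially close to 1 random signs realise linearly many of their bad patterns,
  each of which forces an error.
\<close>

section \<open>Bernstein's inequality\<close>

text \<open>On the unit circle (z + 1/z)/2 is Re z, so |Q| <= M there and, by the maximum principle,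
  in the disc. Outside the disc the symmetry Q(z) = z^(2n) Q(1/z) gives the growth factor. Writing
  \<open>Q\<close> as a sum without division makes it entire, including at 0.\<close>

lemma norm_poly_Joukowski_le:
  fixes p :: "complex poly" and M :: real
  assumes deg: "degree p \<le> n"
    and M: "\<And>t. t \<in> {-1..1::real} \<Longrightarrow> cmod (poly p (of_real t)) \<le> M"
  defines "Q \<equiv> (\<lambda>z::complex. \<Sum>i\<le>n. coeff p i / 2 ^ i * (z\<^sup>2 + 1) ^ i * z ^ (n - i))"
  shows "z \<noteq> 0 \<Longrightarrow> Q z = z ^ n * poly p ((z + 1 / z) / 2)"
    and "cmod (Q z) \<le> M * max 1 (cmod z) ^ (2 * n)"
proof -
  have eq: "Q z = z ^ n * poly p ((z + 1 / z) / 2)" if "z \<noteq> 0" for z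
  proof -
    have "poly p ((z + 1 / z) / 2) = (\<Sum>i\<le>n. coeff p i * ((z + 1 / z) / 2) ^ i)"
      unfolding poly_altdef using deg
      by (intro sum.mono_neutral_left) (auto simp: coeff_eq_0)
    also have "z ^ n * \<dots> = (\<Sum>i\<le>n. coeff p i / 2 ^ i * (z\<^sup>2 + 1) ^ i * z ^ (n - i))"
      unfolding sum_distrib_left
    proof (intro sum.cong refl)
      fix i assume "i \<in> {..n}"
      then have n: "z ^ n = z ^ i * z ^ (n - i)" by (simp flip: power_add)
      have "z * ((z + 1 / z) / 2) = (z\<^sup>2 + 1) / 2"
        using that by (simp add: field_simps power2_eq_square)
      then have "z ^ i * ((z + 1 / z) / 2) ^ i = ((z\<^sup>2 + 1) / 2) ^ i"
        by (metis power_mult_distrib)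
      then show "z ^ n * (coeff p i * ((z + 1 / z) / 2) ^ i)
          = coeff p i / 2 ^ i * (z\<^sup>2 + 1) ^ i * z ^ (n - i)"
        unfolding n by (simp add: power_divide field_simps)
    qed
    finally show ?thesis by (simp add: Q_def)
  qed
  then show "z \<noteq> 0 \<Longrightarrow> Q z = z ^ n * poly p ((z + 1 / z) / 2)" .
  have holo: "Q holomorphic_on S" for S
    unfolding Q_def by (intro holomorphic_intros)
  have circle: "cmod (Q z) \<le> M" if "cmod z = 1" for z
  proof -
    have z0: "z \<noteq> 0" using that by auto
    have "1 / z = cnj z"
      using that z0 complex_norm_square[of z] by (simp add: field_simps)
    then have "(z + 1 / z) / 2 = of_real (Re z)" by (simp add: complex_add_cnj)
    moreover have "\<bar>Re z\<bar> \<le> 1" using abs_Re_le_cmod[of z] that by simp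
    ultimately have "cmod (poly p ((z + 1 / z) / 2)) \<le> M"
      using M[of "Re z"] by (simp add: abs_le_iff)
    then show ?thesis using eq[OF z0] that by (simp add: norm_mult norm_power)
  qed
  have disc: "cmod (Q z) \<le> M" if "cmod z \<le> 1" for z
    by (rule maximum_modulus_frontier[of Q "cball 0 1"])
      (use that in \<open>auto intro!: holo holomorphic_on_imp_continuous_on circle\<close>)
  show "cmod (Q z) \<le> M * max 1 (cmod z) ^ (2 * n)"
  proof (cases "cmod z \<le> 1")
    case True
    then show ?thesis using disc by (simp add: max_def)
  next
    case False
    then have z0: "z \<noteq> 0" by auto
    then have "z ^ n * Q (1 / z) = poly p ((z + 1 / z) / 2)"
      using eq[of "1 / z"] by (simp add: power_divide add.commute)
    with z0 have "Q z = z ^ (2 * n) * Q (1 / z)"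
      using eq[of z] by (simp add: mult_2 power_add)
    moreover have "cmod (Q (1 / z)) \<le> M" using False by (intro disc) (simp add: norm_divide divide_le_eq)
    ultimately show ?thesis using False
      by (simp add: norm_mult norm_power mult.commute max_def mult_right_mono)
  qed
qed

text \<open>p(cos t) = e^(-int) Q(e^(it)) for the entire function \<open>Q\<close> of the preceding
  lemma. Cauchy's estimate on a circle of radius 1/(2n), where |Q| <= (1 + 1/(2n))^(2n) M <= 3M,
  gives |Q'| <= 6nM, and differentiating the exponential adds nM. The constant 7 stands in for the
  sharp constant 1.\<close>

lemma Bernstein_inequality_complex:
  fixes p :: "complex poly" and M \<theta> :: real
  assumes deg: "degree p \<le> n"
    and M: "\<And>t. t \<in> {-1..1::real} \<Longrightarrow> cmod (poly p (of_real t)) \<le> M"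
  shows "cmod (poly (pderiv p) (of_real (cos \<theta>)) * of_real (sin \<theta>)) \<le> 7 * real n * M"
proof (cases "n = 0")
  case True
  then have "pderiv p = 0" using deg by (simp add: pderiv_eq_0_iff)
  then show ?thesis using True by simp
next
  case False
  define Q where "Q = (\<lambda>z::complex. \<Sum>i\<le>n. coeff p i / 2 ^ i * (z\<^sup>2 + 1) ^ i * z ^ (n - i))"
  have Q: "z \<noteq> 0 \<Longrightarrow> Q z = z ^ n * poly p ((z + 1 / z) / 2)"
      "cmod (Q z) \<le> M * max 1 (cmod z) ^ (2 * n)" for z
    unfolding Q_def using norm_poly_Joukowski_le[OF deg M] by blast+
  have M0: "0 \<le> M" using order_trans[OF norm_ge_zero M[of 0]] by simp
  have holo: "Q holomorphic_on S" for S
    unfolding Q_def by (intro holomorphic_intros)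
  define z where "z = cis \<theta>"
  have z: "cmod z = 1" "z \<noteq> 0" by (auto simp: z_def)
  have Qd: "cmod (deriv Q z) \<le> 2 * real n * (3 * M)"
  proof -
    define r where "r = 1 / (2 * real n)"
    have r: "r > 0" using False by (simp add: r_def)
    have "cmod (Q w) \<le> 3 * M" if "cmod (z - w) = r" for w
    proof -
      have "cmod w \<le> 1 + r" using norm_triangle_ineq4[of z "z - w"] that z by simp
      then have "max 1 (cmod w) \<le> exp r" using exp_ge_add_one_self[of r] r by linarith
      then have "max 1 (cmod w) ^ (2 * n) \<le> exp r ^ (2 * n)" by (intro power_mono) auto
      also have "\<dots> = exp 1" using False by (simp add: r_def flip: exp_of_nat_mult)
      also have "\<dots> \<le> 3" by (rule exp_le)
      finally have "M * max 1 (cmod w) ^ (2 * n) \<le> M * 3" using M0 by (rule mult_left_mono)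
      then show ?thesis using Q(2)[of w] by simp
    qed
    then have "cmod ((deriv ^^ 1) Q z) \<le> fact 1 * (3 * M) / r ^ 1"
      by (intro Cauchy_inequality holo r holomorphic_on_imp_continuous_on) auto
    then show ?thesis by (simp add: r_def mult.commute)
  qed
  have "((\<lambda>t. cis (- real n * t) * Q (cis t)) has_vector_derivative
      (cis (- real n * \<theta>) * (deriv Q z * (\<i> * z)) + (- real n * \<i>) * cis (- real n * \<theta>) * Q z)) (at \<theta>)"
  proof -
    have cis: "((\<lambda>t. cis (a * t)) has_vector_derivative (of_real a * \<i> * cis (a * \<theta>))) (at \<theta>)" for a :: real
    proof -
      have "((\<lambda>t. exp (\<i> * of_real a * of_real t)) has_vector_derivative (exp (\<i> * of_real a * of_real \<theta>) * (\<i> * of_real a))) (at \<theta>)"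
        by (rule has_vector_derivative_real_field) (auto intro!: derivative_eq_intros)
      then show ?thesis by (simp add: cis_conv_exp mult_ac)
    qed
    have "(Q has_field_derivative deriv Q z) (at (cis \<theta>))"
      unfolding z_def by (rule holomorphic_derivI[OF holo[of UNIV]]) auto
    from field_vector_diff_chain_at[OF cis[of 1, simplified] this]
    have "((\<lambda>t. Q (cis t)) has_vector_derivative (\<i> * z * deriv Q z)) (at \<theta>)"
      by (simp add: o_def z_def)
    from has_vector_derivative_mult[OF cis[of "- real n"] this] show ?thesis
      by (simp add: z_def algebra_simps)
  qed
  moreover have "cis (- real n * t) * Q (cis t) = poly p (of_real (cos t))" for t
  proof -
    have "(cis t + 1 / cis t) / 2 = of_real (cos t)"
      by (simp add: complex_eq_iff cis_divide[of 0, simplified] flip: cis_inverse inverse_eq_divide)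
    moreover have "cis (- real n * t) * cis t ^ n = 1"
      by (simp add: Complex.DeMoivre cis_mult)
    ultimately show ?thesis using Q(1)[of "cis t"] by (simp add: mult.assoc[symmetric])
  qed
  ultimately have 1: "((\<lambda>t. poly p (of_real (cos t))) has_vector_derivative
      (cis (- real n * \<theta>) * (deriv Q z * (\<i> * z)) + (- real n * \<i>) * cis (- real n * \<theta>) * Q z)) (at \<theta>)"
    by simp
  have 2: "((\<lambda>t. poly p (of_real (cos t))) has_vector_derivative
      (of_real (- sin \<theta>) * poly (pderiv p) (of_real (cos \<theta>)))) (at \<theta>)"
  proof -
    have "((\<lambda>t. complex_of_real (cos t)) has_vector_derivative of_real (- sin \<theta>)) (at \<theta>)"
      by (intro has_vector_derivative_of_real)
        (auto intro!: derivative_eq_intros simp flip: has_real_derivative_iff_has_vector_derivative)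
    from field_vector_diff_chain_at[OF this poly_DERIV] show ?thesis by (simp add: o_def)
  qed
  have "of_real (- sin \<theta>) * poly (pderiv p) (of_real (cos \<theta>))
     = cis (- real n * \<theta>) * (deriv Q z * (\<i> * z)) + (- real n * \<i>) * cis (- real n * \<theta>) * Q z"
    using vector_derivative_unique_at[OF 2 1] .
  then have "cmod (of_real (- sin \<theta>) * poly (pderiv p) (of_real (cos \<theta>)))
     \<le> cmod (deriv Q z) + real n * cmod (Q z)"
    using norm_triangle_ineq[of "cis (- real n * \<theta>) * (deriv Q z * (\<i> * z))"
        "(- real n * \<i>) * cis (- real n * \<theta>) * Q z"] z
    by (simp add: norm_mult)
  also have "\<dots> \<le> 2 * real n * (3 * M) + real n * M"
    using Qd Q(2)[of z] z by (intro add_mono mult_left_mono) auto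
  finally show ?thesis by (simp add: norm_mult mult.commute)
qed

lemma poly_of_real_map_poly: "poly (map_poly of_real p) (of_real x :: complex) = of_real (poly p x)"
  by (induction p) (auto simp: map_poly_pCons)

lemma Bernstein_inequality:
  fixes p :: "real poly" and M \<theta> :: real
  assumes deg: "degree p \<le> n" and M: "\<And>t. t \<in> {-1..1} \<Longrightarrow> \<bar>poly p t\<bar> \<le> M"
  shows "\<bar>poly (pderiv p) (cos \<theta>) * sin \<theta>\<bar> \<le> 7 * real n * M"
proof -
  let ?p = "map_poly of_real p :: complex poly"
  have "pderiv ?p = map_poly of_real (pderiv p)"
    by (rule poly_eqI) (simp add: coeff_pderiv coeff_map_poly)
  then show ?thesis
    using Bernstein_inequality_complex[of ?p n M \<theta>] deg M
    by (simp add: poly_of_real_map_poly degree_map_poly flip: of_real_mult)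
qed

text \<open>In the angular variable the Lipschitz constant is uniform up to the endpoints of
  [-1, 1]; this is the form that serves near them.\<close>

lemma poly_cos_Lipschitz:
  fixes p :: "real poly" and M \<theta> \<phi> :: real
  assumes deg: "degree p \<le> n" and M: "\<And>t. t \<in> {-1..1} \<Longrightarrow> \<bar>poly p t\<bar> \<le> M"
  shows "\<bar>poly p (cos \<theta>) - poly p (cos \<phi>)\<bar> \<le> 7 * real n * M * \<bar>\<theta> - \<phi>\<bar>"
proof -
  have "norm (poly p (cos \<theta>) - poly p (cos \<phi>)) \<le> 7 * real n * M * norm (\<theta> - \<phi>)"
    by (rule field_differentiable_bound[of UNIV _ "\<lambda>t. - (poly (pderiv p) (cos t) * sin t)"])
      (use Bernstein_inequality[OF deg M] in \<open>auto intro!: derivative_eq_intros\<close>)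
  then show ?thesis by simp
qed

text \<open>Away from the endpoints the factor sin(arccos x) in Bernstein's inequality is at least
  sin \<tau> and can be divided out.\<close>

lemma poly_deriv_bound_Icc_cos:
  fixes p :: "real poly" and M \<tau> x :: real
  assumes deg: "degree p \<le> n" and M: "\<And>t. t \<in> {-1..1} \<Longrightarrow> \<bar>poly p t\<bar> \<le> M"
    and \<tau>: "0 < \<tau>" "\<tau> \<le> pi / 2" and x: "\<bar>x\<bar> \<le> cos \<tau>"
  shows "\<bar>poly (pderiv p) x\<bar> \<le> 7 / sin \<tau> * real n * M"
proof -
  have s: "sin \<tau> > 0" using \<tau> pi_gt_zero by (intro sin_gt_zero) linarith+
  have x1: "\<bar>x\<bar> \<le> 1" using x cos_le_one[of \<tau>] by linarith
  have "sin \<tau> = sqrt (1 - (cos \<tau>)\<^sup>2)" using s by (intro sin_cos_sqrt) simp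
  also have "\<dots> \<le> sqrt (1 - x\<^sup>2)" using x by (simp add: abs_le_square_iff[symmetric])
  also have "\<dots> = sin (arccos x)" using x1 by (simp add: sin_arccos_abs)
  finally have le: "sin \<tau> \<le> sin (arccos x)" .
  then have "\<bar>poly (pderiv p) x\<bar> * sin \<tau> \<le> \<bar>poly (pderiv p) x\<bar> * sin (arccos x)"
    by (rule mult_left_mono) simp
  also have "\<dots> \<le> 7 * real n * M"
    using Bernstein_inequality[OF deg M, of "arccos x"] x1 s le
    by (simp add: cos_arccos_abs abs_mult)
  finally show ?thesis using s by (simp add: field_simps)
qed

lemma poly_Lipschitz_Icc_cos:
  fixes p :: "real poly" and M \<tau> x y :: real
  assumes deg: "degree p \<le> n" and M: "\<And>t. t \<in> {-1..1} \<Longrightarrow> \<bar>poly p t\<bar> \<le> M"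
    and \<tau>: "0 < \<tau>" "\<tau> \<le> pi / 2" and x: "\<bar>x\<bar> \<le> cos \<tau>" "\<bar>y\<bar> \<le> cos \<tau>"
  shows "\<bar>poly p x - poly p y\<bar> \<le> 7 / sin \<tau> * real n * M * \<bar>x - y\<bar>"
proof -
  have "norm (poly p x - poly p y) \<le> 7 / sin \<tau> * real n * M * norm (x - y)"
    by (rule field_differentiable_bound[of "{- cos \<tau>..cos \<tau>}" _ "poly (pderiv p)"])
      (use x poly_deriv_bound_Icc_cos[OF deg M \<tau>] in
        \<open>auto intro!: has_field_derivative_at_within[OF poly_DERIV] simp: abs_le_iff\<close>)
  then show ?thesis by simp
qed

section \<open>Separated sets\<close>

definition separated :: "real \<Rightarrow> real set \<Rightarrow> bool" where
  "separated s A \<longleftrightarrow> (\<forall>x\<in>A. \<forall>y\<in>A. x \<noteq> y \<longrightarrow> s \<le> \<bar>x - y\<bar>)"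

lemma separated_subset: "separated s A \<Longrightarrow> B \<subseteq> A \<Longrightarrow> separated s B"
  unfolding separated_def by blast

lemma separated_translate: "separated s A \<Longrightarrow> separated s ((\<lambda>x. x - a) ` A)"
  by (simp add: separated_def)

lemma separated_reflect: "separated s A \<Longrightarrow> separated s ((\<lambda>x. a - x) ` A)"
  unfolding separated_def by (smt (verit) image_iff)

text \<open>Cells of length s contain at most one point each, so the map to the index of the cell is
  injective.\<close>

lemma card_separated_Icc_le:
  assumes "finite A" "separated s A" "0 < s" "A \<subseteq> {u..v}" "u \<le> v"
  shows "real (card A) \<le> (v - u) / s + 1"
proof -
  have inj: "inj_on (\<lambda>x. \<lfloor>(x - u) / s\<rfloor>) A"
  proof (rule inj_onI, rule ccontr)
    fix x y assume xy: "x \<in> A" "y \<in> A" "\<lfloor>(x - u) / s\<rfloor> = \<lfloor>(y - u) / s\<rfloor>" "x \<noteq> y"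
    then have "\<bar>(x - u) / s - (y - u) / s\<bar> < 1"
      using floor_correct[of "(x - u) / s"] floor_correct[of "(y - u) / s"] by linarith
    moreover have "(x - u) / s - (y - u) / s = (x - y) / s" by (simp add: diff_divide_distrib)
    ultimately have "\<bar>x - y\<bar> < s" using \<open>0 < s\<close> by (simp add: abs_divide)
    then show False using xy assms(2) by (force simp: separated_def)
  qed
  have sub: "(\<lambda>x. \<lfloor>(x - u) / s\<rfloor>) ` A \<subseteq> {0..\<lfloor>(v - u) / s\<rfloor>}"
    using assms(3) subsetD[OF assms(4)] by (auto intro!: floor_mono divide_right_mono)
  have "card A = card ((\<lambda>x. \<lfloor>(x - u) / s\<rfloor>) ` A)" using inj by (simp add: card_image)
  also have "\<dots> \<le> card {0..\<lfloor>(v - u) / s\<rfloor>}" using sub by (intro card_mono) auto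
  finally have "card A \<le> nat (\<lfloor>(v - u) / s\<rfloor> + 1)" by simp
  moreover have "0 \<le> \<lfloor>(v - u) / s\<rfloor>" using assms by simp
  ultimately have "int (card A) \<le> \<lfloor>(v - u) / s\<rfloor> + 1" by linarith
  then show ?thesis using floor_correct[of "(v - u) / s"] by linarith
qed

text \<open>Telescoping: 1/b^2 <= 1/(b(b - s)) = (1/(b - s) - 1/b)/s. The bound \<open>y\<close> is
  kept variable because, once the largest point b is removed, the induction hypothesis is used with
  b - s in its place.\<close>

lemma sum_inverse_square_separated_le:
  assumes "finite A" "separated s A" "0 < s" "s < L" "A \<subseteq> {L..}"
    and "L - s \<le> y" "\<And>x. x \<in> A \<Longrightarrow> x \<le> y"
  shows "(\<Sum>x\<in>A. 1 / x\<^sup>2) \<le> (1 / (L - s) - 1 / y) / s"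
  using assms(1,2,5-)
proof (induction A arbitrary: y rule: finite_linorder_max_induct)
  case empty
  then show ?case using assms by (auto intro!: divide_nonneg_pos simp: field_simps)
next
  case (insert b A)
  have b: "L \<le> b" "b \<le> y" using insert by auto
  have le: "x \<le> b - s" if "x \<in> A" for x
    using insert.prems(1) insert.hyps(2) that unfolding separated_def by fastforce
  have "(\<Sum>x\<in>A. 1 / x\<^sup>2) \<le> (1 / (L - s) - 1 / (b - s)) / s"
    using insert.prems b le by (intro insert.IH) (auto intro: separated_subset)
  moreover have "1 / b\<^sup>2 \<le> (1 / (b - s) - 1 / b) / s"
  proof -
    have "(1 / (b - s) - 1 / b) / s = 1 / (b * (b - s))" using b assms by (simp add: field_simps)
    moreover have "b * (b - s) \<le> b\<^sup>2" using b assms by (simp add: power2_eq_square)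
    ultimately show ?thesis using b assms by (auto intro!: divide_left_mono)
  qed
  moreover have "1 / y \<le> 1 / b" using b assms by (intro divide_left_mono) auto
  ultimately have "(\<Sum>x\<in>insert b A. 1 / x\<^sup>2) \<le> (1 / (L - s) - 1 / (b - s)) / s + (1 / (b - s) - 1 / b) / s"
    using insert by (subst sum.insert) auto
  also have "\<dots> = (1 / (L - s) - 1 / b) / s" by (simp add: diff_divide_distrib)
  also have "\<dots> \<le> (1 / (L - s) - 1 / y) / s"
    using \<open>1 / y \<le> 1 / b\<close> assms by (intro divide_right_mono) auto
  finally show ?case .
qed

lemma sum_inverse_square_far_le:
  assumes "finite A" "separated s A" "0 < s" "s < L" "\<And>x. x \<in> A \<Longrightarrow> L \<le> \<bar>x - a\<bar>"
  shows "(\<Sum>x\<in>A. 1 / (x - a)\<^sup>2) \<le> 2 / (s * (L - s))"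
proof -
  have one: "(\<Sum>x\<in>B. 1 / x\<^sup>2) \<le> 1 / (s * (L - s))"
    if "finite B" "separated s B" "B \<subseteq> {L..}" for B
  proof -
    \<comment> \<open>Inserting \<open>L\<close> keeps the maximum meaningful for empty
      \<open>B\<close> and provides L - s <= y.\<close>
    define y where "y = Max (insert L B)"
    have y: "x \<le> y" if "x \<in> insert L B" for x using \<open>finite B\<close> that unfolding y_def by (intro Max_ge) auto
    have "(\<Sum>x\<in>B. 1 / x\<^sup>2) \<le> (1 / (L - s) - 1 / y) / s"
      using that y[of L] assms by (intro sum_inverse_square_separated_le) (auto intro: y)
    also have "\<dots> \<le> (1 / (L - s)) / s"
      using y[of L] assms by (intro divide_right_mono) auto
    finally show ?thesis by (simp add: mult.commute)
  qed
  let ?P = "{x\<in>A. a \<le> x}" and ?N = "{x\<in>A. x < a}"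
  have "(\<Sum>x\<in>A. 1 / (x - a)\<^sup>2) = (\<Sum>x\<in>?P. 1 / (x - a)\<^sup>2) + (\<Sum>x\<in>?N. 1 / (x - a)\<^sup>2)"
    using assms(1) by (subst sum.union_disjoint[symmetric]) (auto intro!: sum.cong)
  also have "(\<Sum>x\<in>?P. 1 / (x - a)\<^sup>2) = (\<Sum>u\<in>(\<lambda>x. x - a) ` ?P. 1 / u\<^sup>2)"
    by (subst sum.reindex) (auto simp: inj_on_def)
  also have "(\<Sum>x\<in>?N. 1 / (x - a)\<^sup>2) = (\<Sum>u\<in>(\<lambda>x. a - x) ` ?N. 1 / u\<^sup>2)"
    by (subst sum.reindex) (auto simp: inj_on_def power2_commute)
  also have "(\<Sum>u\<in>(\<lambda>x. x - a) ` ?P. 1 / u\<^sup>2) \<le> 1 / (s * (L - s))"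
  proof (intro one)
    show "separated s ((\<lambda>x. x - a) ` ?P)" 
      using assms(2) by (intro separated_translate) (auto intro: separated_subset)
    show "(\<lambda>x. x - a) ` ?P \<subseteq> {L..}" using assms(5) by (fastforce simp: abs_if)
  qed (use assms(1) in simp)
  also have "(\<Sum>u\<in>(\<lambda>x. a - x) ` ?N. 1 / u\<^sup>2) \<le> 1 / (s * (L - s))"
  proof (intro one)
    show "separated s ((\<lambda>x. a - x) ` ?N)"
      using assms(2) by (intro separated_reflect) (auto intro: separated_subset)
    show "(\<lambda>x. a - x) ` ?N \<subseteq> {L..}" using assms(5) by (fastforce simp: abs_if)
  qed (use assms(1) in simp)
  finally show ?thesis by simp
qed

section \<open>A polynomial Fejer kernel\<close>

text \<open>The Dirichlet kernel sin((2n + 1) \<phi>) / sin \<phi> as a polynomial in u = 2 sin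
  \<phi>. The recursion is sin(a + 2 \<phi>) + sin(a - 2 \<phi>) = 2 cos(2 \<phi>) sin a, where 2
  cos(2 \<phi>) = 2 - u^2.\<close>

fun dirichlet_poly :: "nat \<Rightarrow> real poly" where
  "dirichlet_poly 0 = 1"
| "dirichlet_poly (Suc 0) = [:3, 0, -1:]"
| "dirichlet_poly (Suc (Suc n)) = [:2, 0, -1:] * dirichlet_poly (Suc n) - dirichlet_poly n"

lemma dirichlet_poly_sin:
  "poly (dirichlet_poly n) (2 * sin \<phi>) * sin \<phi> = sin (real (2 * n + 1) * \<phi>)"
proof (induction n rule: dirichlet_poly.induct)
  case 2
  have "sin (3 * \<phi>) = sin (2 * \<phi> + \<phi>)" by (simp add: algebra_simps)
  also have "\<dots> = (3 - (2 * sin \<phi>)\<^sup>2) * sin \<phi>"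
    unfolding sin_add sin_double cos_double_sin
    using sin_cos_squared_add[of \<phi>] by algebra
  finally show ?case by (simp add: power2_eq_square algebra_simps)
next
  case (3 n)
  let ?a = "real (2 * Suc n + 1) * \<phi>"
  have "real (2 * Suc (Suc n) + 1) * \<phi> = ?a + 2 * \<phi>" "real (2 * n + 1) * \<phi> = ?a - 2 * \<phi>"
    by (simp_all add: algebra_simps)
  then have "sin (real (2 * Suc (Suc n) + 1) * \<phi>) + sin (real (2 * n + 1) * \<phi>) = 2 * sin ?a * cos (2 * \<phi>)"
    by (simp only: sin_add sin_diff)
  also have "\<dots> = 2 * sin ?a * (1 - 2 * (sin \<phi>)\<^sup>2)" by (simp only: cos_double_sin)
  finally have "sin (real (2 * Suc (Suc n) + 1) * \<phi>)
      = (2 - 4 * (sin \<phi>)\<^sup>2) * sin ?a - sin (real (2 * n + 1) * \<phi>)"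
    by (simp add: algebra_simps)
  also have "\<dots> = (2 - 4 * (sin \<phi>)\<^sup>2) * (poly (dirichlet_poly (Suc n)) (2 * sin \<phi>) * sin \<phi>)
      - poly (dirichlet_poly n) (2 * sin \<phi>) * sin \<phi>"
    by (simp only: 3)
  also have "\<dots> = poly (dirichlet_poly (Suc (Suc n))) (2 * sin \<phi>) * sin \<phi>"
    by (simp add: power2_eq_square algebra_simps)
  finally show ?case ..
qed auto

lemma degree_dirichlet_poly: "degree (dirichlet_poly n) \<le> 2 * n"
proof (induction n rule: dirichlet_poly.induct)
  case (3 n)
  have "degree ([:2, 0, -1:] * dirichlet_poly (Suc n)) \<le> 2 + 2 * Suc n"
    using degree_mult_le[of "[:2, 0, -1:]" "dirichlet_poly (Suc n)"] 3 by simp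
  then show ?case using 3 by (simp only: dirichlet_poly.simps) (intro degree_diff_le; simp)
qed auto

lemma poly_dirichlet_poly_0: "poly (dirichlet_poly n) 0 = real (2 * n + 1)"
  by (induction n rule: dirichlet_poly.induct) auto

lemma poly_dirichlet_poly_minus: "poly (dirichlet_poly n) (- u) = poly (dirichlet_poly n) u"
  by (induction n rule: dirichlet_poly.induct) auto

lemma abs_sin_of_nat_mult_le: "\<bar>sin (real m * \<phi>)\<bar> \<le> real m * \<bar>sin \<phi>\<bar>"
proof (induction m)
  case (Suc m)
  have "\<bar>sin (real (Suc m) * \<phi>)\<bar> = \<bar>sin (real m * \<phi>) * cos \<phi> + cos (real m * \<phi>) * sin \<phi>\<bar>"
    by (simp add: distrib_right sin_add algebra_simps)
  also have "\<dots> \<le> \<bar>sin (real m * \<phi>)\<bar> * \<bar>cos \<phi>\<bar> + \<bar>cos (real m * \<phi>)\<bar> * \<bar>sin \<phi>\<bar>"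
    by (simp add: abs_triangle_ineq flip: abs_mult)
  also have "\<dots> \<le> \<bar>sin (real m * \<phi>)\<bar> * 1 + 1 * \<bar>sin \<phi>\<bar>"
    by (intro add_mono mult_left_mono mult_right_mono) auto
  finally show ?case using Suc by (simp add: distrib_right)
qed auto

lemma sin_ge_half:
  fixes y :: real
  assumes "0 \<le> y" "y \<le> 1"
  shows "y / 2 \<le> sin y"
proof -
  have "sin 0 - 0 / 2 \<le> sin y - y / 2"
  proof (rule DERIV_nonneg_imp_nondecreasing[of 0 y "\<lambda>x. sin x - x / 2"])
    fix x assume x: "0 \<le> x" "x \<le> y"
    have "cos (pi / 3) \<le> cos x" using x assms pi_gt3 by (intro cos_monotone_0_pi_le) auto
    then show "\<exists>d. ((\<lambda>x. sin x - x / 2) has_real_derivative d) (at x) \<and> 0 \<le> d"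
      by (intro exI[of _ "cos x - 1 / 2"]) (auto intro!: derivative_eq_intros simp: cos_60)
  qed (use assms in auto)
  then show ?thesis by simp
qed

text \<open>The variable is \<open>u = 2 sin \<phi>\<close>, which ranges over \<open>[-2, 2]\<close>: differences of points of
  \<open>[-1, 1]\<close> can be substituted, and the result is a polynomial in either point.\<close>

definition fejer_poly :: "nat \<Rightarrow> real poly" where
  "fejer_poly p = smult (1 / (real (2 * p + 1))\<^sup>2) ((dirichlet_poly p)\<^sup>2)"

lemma poly_fejer_poly: "poly (fejer_poly p) u = (poly (dirichlet_poly p) u / real (2 * p + 1))\<^sup>2"
  by (simp add: fejer_poly_def power_divide)

lemma degree_fejer_poly: "degree (fejer_poly p) \<le> 4 * p"
  using degree_power_le[of "dirichlet_poly p" 2] degree_dirichlet_poly[of p]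
  by (simp add: fejer_poly_def)

lemma poly_fejer_poly_nonneg: "0 \<le> poly (fejer_poly p) u"
  by (simp add: poly_fejer_poly)

lemma poly_fejer_poly_minus: "poly (fejer_poly p) (- u) = poly (fejer_poly p) u"
  by (simp add: poly_fejer_poly poly_dirichlet_poly_minus)

lemma obtain_2_sin:
  fixes u :: real
  assumes "\<bar>u\<bar> \<le> 2"
  obtains \<phi> where "u = 2 * sin \<phi>"
proof
  show "u = 2 * sin (arcsin (u / 2))" using assms by (simp add: abs_le_iff)
qed

text \<open>Off 0 this is |sin(m \<phi>)| <= m |sin \<phi>| for m = 2p + 1. At 0, where sin \<phi>
  cannot be cancelled, the normalisation gives the value 1.\<close>

lemma poly_fejer_poly_le_1:
  assumes "\<bar>u\<bar> \<le> 2"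
  shows "poly (fejer_poly p) u \<le> 1"
proof (cases "u = 0")
  case True
  then show ?thesis by (simp add: poly_fejer_poly poly_dirichlet_poly_0)
next
  case False
  obtain \<phi> where u: "u = 2 * sin \<phi>" using obtain_2_sin[OF assms] .
  have "\<bar>poly (dirichlet_poly p) u\<bar> * \<bar>sin \<phi>\<bar> \<le> real (2 * p + 1) * \<bar>sin \<phi>\<bar>"
    using abs_sin_of_nat_mult_le[of "2 * p + 1" \<phi>] dirichlet_poly_sin[of p \<phi>] u
    by (metis abs_mult)
  then have "\<bar>poly (dirichlet_poly p) u\<bar> \<le> real (2 * p + 1)" using False u by simp
  then show ?thesis by (simp add: poly_fejer_poly power_divide abs_le_square_iff[symmetric] power2_eq_square[symmetric] divide_le_eq)
qed

text \<open>Multiplying the Dirichlet factor by u = 2 sin \<phi> leaves 2 sin((2p + 1) \<phi>),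
  which is bounded by 2.\<close>

lemma poly_fejer_poly_decay:
  assumes "\<bar>u\<bar> \<le> 2"
  shows "poly (fejer_poly p) u * u\<^sup>2 \<le> 4 / (real (2 * p + 1))\<^sup>2"
proof -
  obtain \<phi> where u: "u = 2 * sin \<phi>" using obtain_2_sin[OF assms] .
  have "poly (fejer_poly p) u * u\<^sup>2 = 4 * (poly (dirichlet_poly p) u * sin \<phi>)\<^sup>2 / (real (2 * p + 1))\<^sup>2"
    using u by (simp add: poly_fejer_poly power_divide power_mult_distrib)
  also have "(poly (dirichlet_poly p) u * sin \<phi>)\<^sup>2 = (sin (real (2 * p + 1) * \<phi>))\<^sup>2"
    unfolding u dirichlet_poly_sin ..
  also have "4 * (sin (real (2 * p + 1) * \<phi>))\<^sup>2 \<le> 4 * 1"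
    using abs_sin_le_one by (intro mult_left_mono) (auto simp: abs_square_le_1)
  finally show ?thesis by (simp add: divide_right_mono)
qed

text \<open>For m = 2p + 1 and 0 < u <= 1/m one has \<phi> <= u, hence m \<phi> <= 1 and sin(m
  \<phi>) >= m \<phi> / 2 >= m sin(\<phi>) / 2. The normalised Dirichlet factor is thus at least
  1/2, and its square at least 1/4; evenness covers negative u.\<close>

lemma poly_fejer_poly_ge:
  assumes "\<bar>u\<bar> \<le> 1 / real (2 * p + 1)"
  shows "1 / 4 \<le> poly (fejer_poly p) u"
proof -
  let ?m = "real (2 * p + 1)"
  have main: "1 / 4 \<le> poly (fejer_poly p) u" if u: "0 < u" "u \<le> 1 / ?m" for u
  proof -
    have "1 / ?m \<le> 1" by simp
    then have u1: "u \<le> 1" using u by linarith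
    define \<phi> where "\<phi> = arcsin (u / 2)"
    have s: "sin \<phi> = u / 2" using u u1 by (simp add: \<phi>_def)
    have \<phi>: "0 < \<phi>" "\<phi> \<le> pi / 2" using u u1 arcsin_bounded[of "u/2"] arcsin_less_arcsin[of 0 "u/2"] by (auto simp: \<phi>_def)
    have "u / 2 \<le> sin u" using u u1 by (intro sin_ge_half) auto
    then have "\<phi> \<le> arcsin (sin u)" unfolding \<phi>_def using u u1 by (intro arcsin_le_arcsin) auto
    also have "\<dots> = u" using u u1 pi_gt3 by (intro arcsin_sin) auto
    finally have "?m * \<phi> \<le> ?m * u" by (intro mult_left_mono) auto
    also have "\<dots> \<le> 1" using u by (simp add: field_simps)
    finally have "?m * \<phi> / 2 \<le> sin (?m * \<phi>)" using \<phi> by (intro sin_ge_half) auto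
    moreover have "?m * sin \<phi> \<le> ?m * \<phi>" using \<phi> by (intro mult_left_mono sin_x_le_x) auto
    moreover have "sin (?m * \<phi>) = poly (dirichlet_poly p) u * sin \<phi>"
      using dirichlet_poly_sin[of p \<phi>] by (simp add: s)
    ultimately have "?m / 2 * sin \<phi> \<le> poly (dirichlet_poly p) u * sin \<phi>" by linarith
    then have "?m / 2 \<le> poly (dirichlet_poly p) u"
      using s u by simp
    then have "1 / 2 \<le> poly (dirichlet_poly p) u / ?m" by (simp add: field_simps)
    then have "(1 / 2)\<^sup>2 \<le> (poly (dirichlet_poly p) u / ?m)\<^sup>2" by (intro power_mono) auto
    then show ?thesis by (simp add: poly_fejer_poly power2_eq_square)
  qed
  consider "u = 0" | "u > 0" | "u < 0" by linarith
  then show ?thesis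
  proof cases
    case 1
    then show ?thesis by (simp add: poly_fejer_poly poly_dirichlet_poly_0)
  next
    case 2
    then show ?thesis using main[of u] assms by simp
  next
    case 3
    then show ?thesis using main[of "- u"] assms by (simp add: poly_fejer_poly_minus)
  qed
qed

lemma sum_fejer_poly_far_le:
  fixes p :: nat
  defines "r \<equiv> 1 / real (2 * p + 1)"
  assumes "finite A" "separated s A" "0 < s" "s < L" "\<And>x. x \<in> A \<Longrightarrow> L \<le> \<bar>x - a\<bar> \<and> \<bar>x - a\<bar> \<le> 2"
  shows "(\<Sum>x\<in>A. poly (fejer_poly p) (x - a)) \<le> 8 * r\<^sup>2 / (s * (L - s))"
proof -
  have "(\<Sum>x\<in>A. poly (fejer_poly p) (x - a)) \<le> (\<Sum>x\<in>A. 4 * r\<^sup>2 * (1 / (x - a)\<^sup>2))"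
  proof (rule sum_mono)
    fix x assume x: "x \<in> A"
    then have "\<bar>x - a\<bar> > 0" using assms by force
    then show "poly (fejer_poly p) (x - a) \<le> 4 * r\<^sup>2 * (1 / (x - a)\<^sup>2)"
      using poly_fejer_poly_decay[of "x - a" p] assms(6)[OF x]
      by (simp add: r_def power_divide pos_le_divide_eq mult_ac)
  qed
  also have "\<dots> = 4 * r\<^sup>2 * (\<Sum>x\<in>A. 1 / (x - a)\<^sup>2)" by (simp add: sum_distrib_left)
  also have "\<dots> \<le> 4 * r\<^sup>2 * (2 / (s * (L - s)))"
    using assms by (intro mult_left_mono sum_inverse_square_far_le) auto
  finally show ?thesis by simp
qed

text \<open>The sum is split at distance r + s. Each of the at most 2r/s + 3 nearer points
  contributes at most 1, and the quadratic decay bounds the farther ones together by 8r/s.\<close>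

lemma sum_fejer_poly_le:
  fixes p :: nat
  defines "r \<equiv> 1 / real (2 * p + 1)"
  assumes "finite A" "separated s A" "0 < s" "\<And>x. x \<in> A \<Longrightarrow> \<bar>x - a\<bar> \<le> 2"
  shows "(\<Sum>x\<in>A. poly (fejer_poly p) (x - a)) \<le> 10 * r / s + 3"
proof -
  have r: "r > 0" by (simp add: r_def)
  let ?N = "{x\<in>A. \<bar>x - a\<bar> < r + s}" and ?F = "{x\<in>A. r + s \<le> \<bar>x - a\<bar>}"
  have "(\<Sum>x\<in>A. poly (fejer_poly p) (x - a))
      = (\<Sum>x\<in>?N. poly (fejer_poly p) (x - a)) + (\<Sum>x\<in>?F. poly (fejer_poly p) (x - a))"
    using assms(2) by (subst sum.union_disjoint[symmetric]) (auto intro!: sum.cong)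
  moreover have "(\<Sum>x\<in>?N. poly (fejer_poly p) (x - a)) \<le> 2 * r / s + 3"
  proof -
    have "(\<Sum>x\<in>?N. poly (fejer_poly p) (x - a)) \<le> (\<Sum>x\<in>?N. 1)"
      using assms by (intro sum_mono poly_fejer_poly_le_1) auto
    also have "\<dots> = real (card ?N)" by simp
    also have "\<dots> \<le> ((a + (r + s)) - (a - (r + s))) / s + 1"
      using assms r by (intro card_separated_Icc_le separated_subset[OF assms(3)]) auto
    also have "\<dots> = 2 * r / s + 3" using assms(4) by (simp add: add_divide_distrib diff_divide_distrib)
    finally show ?thesis .
  qed
  moreover have "(\<Sum>x\<in>?F. poly (fejer_poly p) (x - a)) \<le> 8 * r / s"
  proof -
    have "(\<Sum>x\<in>?F. poly (fejer_poly p) (x - a)) \<le> 8 * r\<^sup>2 / (s * ((r + s) - s))"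
      unfolding r_def using assms r
      by (intro sum_fejer_poly_far_le) (auto simp: r_def intro: separated_subset)
    also have "\<dots> = 8 * r / s" using r by (simp add: power2_eq_square)
    finally show ?thesis .
  qed
  moreover have "10 * r / s = 2 * r / s + 8 * r / s" by (simp flip: add_divide_distrib)
  ultimately show ?thesis by linarith
qed

section \<open>Pairs of close points\<close>

text \<open>The admissible powers form a geometric sum dominated by twice its largest term, which is
  at most r/u. This allows 1/u to be bounded below by a sum over dyadic scales.\<close>

lemma sum_powers2_le_inverse:
  fixes u r :: real
  assumes "u > 0" "r > 0"
  shows "(\<Sum>i\<le>I. if u * 2 ^ i \<le> r then 2 ^ i else 0) \<le> 2 * (r / u)"
proof (induction I)
  case 0
  then show ?case using assms by (cases "u \<le> r") (auto simp: pos_le_divide_eq)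
next
  case (Suc I)
  show ?case
  proof (cases "u * 2 ^ Suc I \<le> r")
    case True
    have "(\<Sum>i\<le>Suc I. if u * 2 ^ i \<le> r then 2 ^ i else 0) \<le> (\<Sum>i\<le>Suc I. (2::real) ^ i)"
      by (intro sum_mono) auto
    also have "\<dots> = 2 * 2 ^ Suc I - 1"
      using sum_gp[of "2::real" 0 "Suc I"] by (simp add: atMost_atLeast0)
    also have "\<dots> \<le> 2 * (r / u)" using True assms by (simp add: field_simps)
    finally show ?thesis .
  qed (use Suc in simp)
qed

text \<open>Points in one cell of length r are close. There are at most 4/r cells, so by
  Cauchy-Schwarz at least r |A|^2 / 4 ordered pairs share a cell. The diagonal accounts for |A| <= r
  |A|^2 / 8 of them, by the last hypothesis.\<close>

lemma card_close_pairs_ge: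
  assumes "finite A" "A \<subseteq> {-1..1}" "0 < r" "r \<le> 1" "8 \<le> r * real (card A)"
  shows "r * (real (card A))\<^sup>2 / 8 \<le> real (card {(x, y) \<in> A \<times> A. x \<noteq> y \<and> \<bar>x - y\<bar> \<le> r})"
proof -
  define f where "f x = \<lfloor>x / r\<rfloor>" for x
  define B where "B = f ` A"
  define c where "c k = card {x \<in> A. f x = k}" for k
  have "finite B" using assms(1) by (simp add: B_def)
  have "B \<subseteq> {\<lfloor>- 1 / r\<rfloor>..\<lfloor>1 / r\<rfloor>}"
  proof -
    have "f x \<in> {\<lfloor>- 1 / r\<rfloor>..\<lfloor>1 / r\<rfloor>}" if "x \<in> A" for x
    proof -
      have "- 1 / r \<le> x / r" "x / r \<le> 1 / r"
        using that subsetD[OF assms(2) that] assms(3) by (intro divide_right_mono; simp)+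
      then show ?thesis by (simp add: f_def floor_mono)
    qed
    then show ?thesis by (auto simp: B_def)
  qed
  then have "card B \<le> card {\<lfloor>- 1 / r\<rfloor>..\<lfloor>1 / r\<rfloor>}" by (intro card_mono) auto
  then have "card B \<le> nat (\<lfloor>1 / r\<rfloor> - \<lfloor>- 1 / r\<rfloor> + 1)" by simp
  moreover have "\<lfloor>- 1 / r\<rfloor> \<le> \<lfloor>1 / r\<rfloor>" using assms by (intro floor_mono) (simp add: divide_right_mono)
  ultimately have "real (card B) \<le> 1 / r - (- 1 / r) + 2" by linarith
  moreover have "1 \<le> 1 / r" using assms by simp
  ultimately have B: "real (card B) \<le> 4 / r" by simp
  have A: "card A = (\<Sum>k\<in>B. c k)"
    unfolding c_def B_def by (subst card_UN_disjoint[symmetric]) (use assms(1) in \<open>auto intro!: arg_cong[of _ _ card]\<close>)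
  let ?P = "{(x, y) \<in> A \<times> A. \<bar>x - y\<bar> \<le> r}"
  have finP: "finite ?P" by (rule finite_subset[of _ "A \<times> A"]) (use assms(1) in auto)
  have "(real (card A))\<^sup>2 \<le> real (card B) * (\<Sum>k\<in>B. (real (c k))\<^sup>2)"
    using sum_squared_le_sum_of_squares[of "\<lambda>k. real (c k)" B] \<open>finite B\<close> by (simp add: A mult.commute)
  also have "\<dots> \<le> 4 / r * (\<Sum>k\<in>B. (real (c k))\<^sup>2)"
    using B by (intro mult_right_mono sum_nonneg) auto
  also have "(\<Sum>k\<in>B. (real (c k))\<^sup>2) = real (card (\<Union>k\<in>B. {x \<in> A. f x = k} \<times> {x \<in> A. f x = k}))"
    using assms(1) \<open>finite B\<close> by (subst card_UN_disjoint) (auto simp: c_def card_cartesian_product power2_eq_square)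
  also have "\<dots> \<le> real (card ?P)"
  proof -
    have "\<bar>x - y\<bar> \<le> r" if "f x = f y" for x y
    proof -
      have "\<bar>x / r - y / r\<bar> < 1"
        using that floor_correct[of "x / r"] floor_correct[of "y / r"] unfolding f_def by linarith
      then show ?thesis using assms by (simp add: abs_divide flip: diff_divide_distrib)
    qed
    then have "(\<Union>k\<in>B. {x \<in> A. f x = k} \<times> {x \<in> A. f x = k}) \<subseteq> ?P" by auto
    then show ?thesis using finP by (simp add: card_mono)
  qed
  finally have "(real (card A))\<^sup>2 \<le> 4 / r * real (card ?P)" using assms by (simp add: divide_right_mono)
  then have 1: "r * (real (card A))\<^sup>2 / 4 \<le> real (card ?P)" using assms by (simp add: field_simps)
  have "?P = {(x, y) \<in> A \<times> A. x \<noteq> y \<and> \<bar>x - y\<bar> \<le> r} \<union> (\<lambda>x. (x, x)) ` A"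
    using assms by auto
  then have "card ?P \<le> card {(x, y) \<in> A \<times> A. x \<noteq> y \<and> \<bar>x - y\<bar> \<le> r} + card A"
    using card_Un_le card_image_le[OF assms(1), of "\<lambda>x. (x, x)"] by (metis (no_types, lifting) add_left_mono order_trans)
  moreover have "8 * real (card A) \<le> r * (real (card A))\<^sup>2"
    using mult_right_mono[OF assms(5), of "real (card A)"] by (simp add: power2_eq_square mult.assoc)
  ultimately show ?thesis using 1 by linarith
qed

text \<open>1/|x - y| is at least the sum of 2^i / (2r) over those i <= I with |x - y| <= r / 2^i.
  By \<open>card_close_pairs_ge\<close> every scale r / 2^i contributes the same amount |A|^2 / 16,
  which produces the logarithmic factor I + 1. The last hypothesis is what that count requires at
  the finest scale.\<close>

lemma sum_inverse_close_pairs_ge: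
  fixes r :: real
  assumes "finite A" "A \<subseteq> {-1..1}" "0 < r" "r \<le> 1" "8 * 2 ^ I \<le> r * real (card A)"
  shows "real (I + 1) * (real (card A))\<^sup>2 / 16
    \<le> (\<Sum>(x, y)\<in>{(x, y) \<in> A \<times> A. x \<noteq> y \<and> \<bar>x - y\<bar> \<le> r}. 1 / \<bar>x - y\<bar>)"
proof -
  let ?Q = "\<lambda>r. {(x, y) \<in> A \<times> A. x \<noteq> y \<and> \<bar>x - y\<bar> \<le> r}"
  have fin: "finite (?Q r)" for r by (rule finite_subset[of _ "A \<times> A"]) (use assms(1) in auto)
  have "real (I + 1) * (real (card A))\<^sup>2 / 16 = (\<Sum>i\<le>I. 2 ^ i / (2 * r) * ((r / 2 ^ i) * (real (card A))\<^sup>2 / 8))"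
    using assms by (simp add: field_simps)
  also have "\<dots> \<le> (\<Sum>i\<le>I. 2 ^ i / (2 * r) * real (card (?Q (r / 2 ^ i))))"
  proof (intro sum_mono mult_left_mono card_close_pairs_ge assms(1,2))
    fix i assume i: "i \<in> {..I}"
    then have le: "(2::real) ^ i \<le> 2 ^ I" by (intro power_increasing) auto
    have "(1::real) \<le> 2 ^ i" by (rule one_le_power) simp
    then have "r \<le> 2 ^ i" using assms(4) by linarith
    then show "r / 2 ^ i \<le> 1" by (simp add: divide_le_eq)
    have "8 * 2 ^ i \<le> r * real (card A)" using le assms(5) by linarith
    then show "8 \<le> r / 2 ^ i * real (card A)" by (simp add: field_simps)
  qed (use assms in auto)
  also have "\<dots> = (\<Sum>i\<le>I. \<Sum>(x, y)\<in>?Q r. (if \<bar>x - y\<bar> * 2 ^ i \<le> r then 2 ^ i / (2 * r) else 0))"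
  proof (rule sum.cong[OF refl])
    fix i assume "i \<in> {..I}"
    have le: "r / 2 ^ i \<le> r" using assms(3) one_le_power[of "2::real" i] by (simp add: divide_le_eq)
    have "(\<Sum>(x, y)\<in>?Q r. (if \<bar>x - y\<bar> * 2 ^ i \<le> r then 2 ^ i / (2 * r) else 0))
       = (\<Sum>(x, y)\<in>?Q (r / 2 ^ i). 2 ^ i / (2 * r))"
    proof (intro sum.mono_neutral_cong_right)
      show "?Q (r / 2 ^ i) \<subseteq> ?Q r" using le by force
    qed (use fin in \<open>auto simp: pos_le_divide_eq split: if_splits\<close>)
    then show "2 ^ i / (2 * r) * real (card (?Q (r / 2 ^ i))) =
      (\<Sum>(x, y)\<in>?Q r. (if \<bar>x - y\<bar> * 2 ^ i \<le> r then 2 ^ i / (2 * r) else 0))"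
      by (simp add: case_prod_unfold)
  qed
  also have "\<dots> = (\<Sum>(x, y)\<in>?Q r. \<Sum>i\<le>I. (if \<bar>x - y\<bar> * 2 ^ i \<le> r then 2 ^ i / (2 * r) else 0))"
    unfolding case_prod_unfold by (rule sum.swap)
  also have "\<dots> \<le> (\<Sum>(x, y)\<in>?Q r. 1 / \<bar>x - y\<bar>)"
  proof (rule sum_mono, clarify)
    fix x y assume "x \<in> A" "y \<in> A" "x \<noteq> y" "\<bar>x - y\<bar> \<le> r"
    then have "(\<Sum>i\<le>I. if \<bar>x - y\<bar> * 2 ^ i \<le> r then 2 ^ i else 0) \<le> 2 * (r / \<bar>x - y\<bar>)"
      using assms by (intro sum_powers2_le_inverse) auto
    then have "(\<Sum>i\<le>I. if \<bar>x - y\<bar> * 2 ^ i \<le> r then 2 ^ i else 0) / (2 * r) \<le> 2 * (r / \<bar>x - y\<bar>) / (2 * r)"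
      using assms by (intro divide_right_mono) auto
    also have "\<dots> = 1 / \<bar>x - y\<bar>" using assms by simp
    also have "(\<Sum>i\<le>I. if \<bar>x - y\<bar> * 2 ^ i \<le> r then 2 ^ i else 0) / (2 * r)
      = (\<Sum>i\<le>I. (if \<bar>x - y\<bar> * 2 ^ i \<le> r then 2 ^ i / (2 * r) else 0))"
      unfolding sum_divide_distrib by (intro sum.cong) auto
    finally show "(\<Sum>i\<le>I. (if \<bar>x - y\<bar> * 2 ^ i \<le> r then 2 ^ i / (2 * r) else 0)) \<le> 1 / \<bar>x - y\<bar>" .
  qed
  finally show ?thesis .
qed

section \<open>Lagrange interpolation and Fekete nodes\<close>

definition lagrange_basis :: "'a::field set \<Rightarrow> 'a \<Rightarrow> 'a poly" where
  "lagrange_basis X j = (\<Prod>x\<in>X - {j}. smult (1 / (j - x)) [:- x, 1:])"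

lemma poly_lagrange_basis: "poly (lagrange_basis X j) t = (\<Prod>x\<in>X - {j}. (t - x) / (j - x))"
  by (simp add: lagrange_basis_def poly_prod) (simp add: algebra_simps diff_divide_distrib)

lemma poly_lagrange_basis_eq:
  assumes "finite X" "j \<in> X" "k \<in> X"
  shows "poly (lagrange_basis X j) k = (if j = k then 1 else 0)"
proof (cases "j = k")
  case True
  then show ?thesis by (auto simp: poly_lagrange_basis intro!: prod.neutral split: if_splits)
next
  case False
  then have "k \<in> X - {j}" using assms by auto
  then show ?thesis using False assms(1) by (auto simp: poly_lagrange_basis intro!: prod_zero)
qed

lemma degree_lagrange_basis_less:
  assumes "finite X" "j \<in> X"
  shows "degree (lagrange_basis X j) < card X"
proof -
  have "degree (lagrange_basis X j) \<le> (\<Sum>x\<in>X - {j}. degree (smult (1 / (j - x)) [:- x, 1:]))"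
    unfolding lagrange_basis_def by (rule order_trans[OF degree_prod_sum_le]) (use assms in auto)
  also have "\<dots> \<le> (\<Sum>x\<in>X - {j}. 1)" by (intro sum_mono) auto
  also have "\<dots> < card X" using card_Diff1_less[OF assms] by simp
  finally show ?thesis .
qed

lemma lagrange_interpolation:
  assumes "finite X" "degree H < card X"
  shows "H = (\<Sum>j\<in>X. smult (poly H j) (lagrange_basis X j))"
proof (rule poly_eqI_degree[of X])
  fix k assume k: "k \<in> X"
  have "poly (\<Sum>j\<in>X. smult (poly H j) (lagrange_basis X j)) k = (\<Sum>j\<in>X. if j = k then poly H j else 0)"
    unfolding poly_sum poly_smult by (intro sum.cong refl) (use assms k in \<open>simp add: poly_lagrange_basis_eq\<close>)
  then show "poly H k = poly (\<Sum>j\<in>X. smult (poly H j) (lagrange_basis X j)) k"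
    using assms k by simp
next
  have "degree (\<Sum>j\<in>X. smult (poly H j) (lagrange_basis X j)) \<le> card X - 1"
    using degree_lagrange_basis_less[OF assms(1)]
    by (intro degree_sum_le assms(1) order_trans[OF degree_smult_le]) fastforce
  then show "degree (\<Sum>j\<in>X. smult (poly H j) (lagrange_basis X j)) < card X"
    using assms by linarith
qed (use assms in auto)

lemma poly_pderiv_lagrange_interpolation:
  assumes "finite X" "degree H < card X"
  shows "poly (pderiv H) t = (\<Sum>j\<in>X. poly H j * poly (pderiv (lagrange_basis X j)) t)"
proof -
  have "pderiv H = pderiv (\<Sum>j\<in>X. smult (poly H j) (lagrange_basis X j))"
    using lagrange_interpolation[OF assms] by simp
  also have "\<dots> = (\<Sum>j\<in>X. smult (poly H j) (pderiv (lagrange_basis X j)))"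
    using higher_pderiv_sum[of 1 "\<lambda>j. smult (poly H j) (lagrange_basis X j)" X] by (simp add: pderiv_smult)
  finally show ?thesis by (simp add: poly_sum)
qed

text \<open>Of the product rule only the term that differentiates the factor vanishing at
  \<open>k\<close> survives.\<close>

lemma poly_pderiv_lagrange_basis:
  assumes "finite X" "k \<in> X" "k \<noteq> j"
  shows "poly (pderiv (lagrange_basis X j)) k = (\<Prod>x\<in>X - {j, k}. (k - x) / (j - x)) / (j - k)"
proof -
  have "X - {j} = insert k (X - {j, k})" using assms by auto
  moreover define R where "R = (\<Prod>x\<in>X - {j, k}. smult (1 / (j - x)) [:- x, 1:])"
  ultimately have "lagrange_basis X j = smult (1 / (j - k)) [:- k, 1:] * R"
    using assms by (simp only: lagrange_basis_def) (subst prod.insert, auto)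
  moreover have "poly R k = (\<Prod>x\<in>X - {j, k}. (k - x) / (j - x))"
    unfolding R_def by (simp add: poly_prod) (simp add: algebra_simps diff_divide_distrib)
  ultimately show ?thesis by (simp only: pderiv_mult pderiv_smult) (simp add: pderiv_pCons)
qed

text \<open>The products over the remaining nodes in the two derivatives are reciprocal to each
  other, so the configuration of those nodes cancels.\<close>

lemma pderiv_lagrange_basis_mult_swap:
  fixes X :: "real set"
  assumes "finite X" "j \<in> X" "k \<in> X" "j \<noteq> k"
  shows "\<bar>poly (pderiv (lagrange_basis X j)) k\<bar> * \<bar>poly (pderiv (lagrange_basis X k)) j\<bar> = (1 / \<bar>j - k\<bar>)\<^sup>2"
proof -
  have "(\<Prod>x\<in>X - {j, k}. (k - x) / (j - x)) * (\<Prod>x\<in>X - {j, k}. (j - x) / (k - x)) = 1"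
    unfolding prod.distrib[symmetric] by (intro prod.neutral) auto
  then have "\<bar>\<Prod>x\<in>X - {j, k}. (k - x) / (j - x)\<bar> * \<bar>\<Prod>x\<in>X - {j, k}. (j - x) / (k - x)\<bar> = 1"
    by (metis abs_mult abs_one)
  moreover have "{k, j} = {j, k}" by auto
  ultimately show ?thesis
    using assms
    by (simp add: poly_pderiv_lagrange_basis abs_divide power2_eq_square abs_minus_commute)
qed

text \<open>The product of the two terms is known exactly, and 4ab <= (a + b)^2.\<close>

lemma pderiv_lagrange_basis_add_swap_ge:
  fixes X :: "real set"
  assumes "finite X" "j \<in> X" "k \<in> X" "j \<noteq> k"
  shows "2 / \<bar>j - k\<bar> \<le> \<bar>poly (pderiv (lagrange_basis X j)) k\<bar> + \<bar>poly (pderiv (lagrange_basis X k)) j\<bar>"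
    (is "_ \<le> ?a + ?b")
proof -
  have "(2 / \<bar>j - k\<bar>)\<^sup>2 = 4 * (?a * ?b)"
    using pderiv_lagrange_basis_mult_swap[OF assms] by (simp add: power_divide)
  also have "\<dots> \<le> (?a + ?b)\<^sup>2"
    using zero_le_power2[of "?a - ?b"] unfolding power2_sum power2_diff by linarith
  finally show ?thesis by (rule power2_le_imp_le) simp
qed

text \<open>Every pair of nodes is counted twice, so this is the square of the modulus of the Vandermonde
  determinant. Replacing a node \<open>a\<close> by \<open>t\<close> multiplies it by the square of the value at \<open>t\<close> of the
  Lagrange polynomial of \<open>a\<close>. Sets within a factor 4 of the supremum suffice, which avoids a
  compactness argument.\<close>

definition node_product :: "real set \<Rightarrow> real" where
  "node_product X = (\<Prod>x\<in>X. \<Prod>y\<in>X - {x}. \<bar>x - y\<bar>)"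

lemma node_product_insert:
  assumes "finite B" "t \<notin> B"
  shows "node_product (insert t B) = node_product B * (\<Prod>x\<in>B. \<bar>t - x\<bar>)\<^sup>2"
proof -
  have "(\<Prod>x\<in>B. \<Prod>y\<in>insert t B - {x}. \<bar>x - y\<bar>) = (\<Prod>x\<in>B. \<bar>t - x\<bar> * (\<Prod>y\<in>B - {x}. \<bar>x - y\<bar>))"
  proof (rule prod.cong[OF refl])
    fix x assume "x \<in> B"
    then have "insert t B - {x} = insert t (B - {x})" using assms by auto
    then show "(\<Prod>y\<in>insert t B - {x}. \<bar>x - y\<bar>) = \<bar>t - x\<bar> * (\<Prod>y\<in>B - {x}. \<bar>x - y\<bar>)"
      using assms by (simp add: abs_minus_commute)
  qed
  moreover have "insert t B - {t} = B" using assms by auto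
  ultimately show ?thesis
    using assms by (simp add: node_product_def prod.distrib power2_eq_square)
qed

lemma node_product_pos: "finite X \<Longrightarrow> 0 < node_product X"
  unfolding node_product_def by (intro prod_pos) auto

text \<open>Exchanging an added node for t gives another competitor, whose product is less than 4
  times that of \<open>X\<close>; as the product is quadratic in the Lagrange value, the bound is 2.
  Nodes of \<Lambda> may not be moved, so only the Lagrange polynomials of added nodes are
  controlled.\<close>

lemma exists_near_Fekete_extension:
  fixes \<Lambda> :: "real set"
  assumes "finite \<Lambda>" "\<Lambda> \<subseteq> {-1..1}" "card \<Lambda> \<le> n"
  obtains X where "finite X" "\<Lambda> \<subseteq> X" "X \<subseteq> {-1..1}" "card X = n"
    "\<And>a t. a \<in> X - \<Lambda> \<Longrightarrow> t \<in> {-1..1} \<Longrightarrow> \<bar>poly (lagrange_basis X a) t\<bar> \<le> 2"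
proof -
  define S where "S = {X. finite X \<and> \<Lambda> \<subseteq> X \<and> X \<subseteq> {-1..1::real} \<and> card X = n}"
  have "infinite ({-1..1::real} - \<Lambda>)" using assms(1) by (simp add: infinite_Icc)
  then obtain B where B: "finite B" "card B = n - card \<Lambda>" "B \<subseteq> {-1..1} - \<Lambda>"
    using infinite_arbitrarily_large by metis
  have "card (\<Lambda> \<union> B) = n" using B assms by (subst card_Un_disjoint) auto
  then have X0: "\<Lambda> \<union> B \<in> S" using B assms by (auto simp: S_def)
  \<comment> \<open>Any bound will do here: it makes the supremum over \<open>S\<close>
    meaningful.\<close>
  have "node_product X \<le> 2 ^ (n * n)" if "X \<in> S" for X
  proof -
    have X: "finite X" "X \<subseteq> {-1..1}" "card X = n" using that by (auto simp: S_def)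
    have "node_product X \<le> (\<Prod>x\<in>X. (2::real) ^ n)"
      unfolding node_product_def
    proof (intro prod_mono conjI prod_nonneg)
      fix x assume x: "x \<in> X"
      have "(\<Prod>y\<in>X - {x}. \<bar>x - y\<bar>) \<le> (\<Prod>y\<in>X - {x}. 2)"
      proof (intro prod_mono)
        fix y assume "y \<in> X - {x}"
        then have "x \<in> {-1..1}" "y \<in> {-1..1}" using X x by auto
        then show "0 \<le> \<bar>x - y\<bar> \<and> \<bar>x - y\<bar> \<le> 2" by auto
      qed
      also have "\<dots> \<le> 2 ^ n" using X x by (simp add: power_increasing)
      finally show "(\<Prod>y\<in>X - {x}. \<bar>x - y\<bar>) \<le> 2 ^ n" .
    qed auto
    then show ?thesis using X by (simp add: power_mult)
  qed
  then have bdd: "bdd_above (node_product ` S)" by (intro bdd_aboveI2)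
  let ?s = "SUP X\<in>S. node_product X"
  have "0 < node_product (\<Lambda> \<union> B)" using B assms by (intro node_product_pos) auto
  also have "\<dots> \<le> ?s" using bdd X0 by (rule cSUP_upper2) simp
  finally have "?s / 4 < ?s" by simp
  then obtain X where X: "X \<in> S" "?s / 4 < node_product X"
    using less_cSUP_iff[of S node_product "?s / 4"] X0 bdd by auto
  then have Xp: "finite X" "\<Lambda> \<subseteq> X" "X \<subseteq> {-1..1}" "card X = n" by (auto simp: S_def)
  have "\<bar>poly (lagrange_basis X a) t\<bar> \<le> 2" if a: "a \<in> X - \<Lambda>" and t: "t \<in> {-1..1}" for a t
  proof (cases "t \<in> X")
    case True
    then show ?thesis using a Xp by (simp add: poly_lagrange_basis_eq)
  next
    case False
    let ?B = "X - {a}"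
    have "card (insert t ?B) = card X"
      using a Xp False card_Suc_Diff1[of X a] by (simp add: card_insert_if)
    then have "insert t ?B \<in> S" using a t Xp by (auto simp: S_def)
    then have "node_product (insert t ?B) \<le> ?s" using bdd by (intro cSUP_upper)
    also have "\<dots> < 4 * node_product X" using X by simp
    also have "X = insert a ?B" using a by auto
    finally have "node_product ?B * (\<Prod>x\<in>?B. \<bar>t - x\<bar>)\<^sup>2 < 4 * (node_product ?B * (\<Prod>x\<in>?B. \<bar>a - x\<bar>)\<^sup>2)"
      using Xp False by (subst (asm) (1 2) node_product_insert) auto
    then have "(\<Prod>x\<in>?B. \<bar>t - x\<bar>)\<^sup>2 < 4 * (\<Prod>x\<in>?B. \<bar>a - x\<bar>)\<^sup>2"
      using node_product_pos[of ?B] Xp by (simp add: mult.left_commute[of 4])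
    then have "(\<Prod>x\<in>?B. \<bar>t - x\<bar>)\<^sup>2 \<le> (2 * (\<Prod>x\<in>?B. \<bar>a - x\<bar>))\<^sup>2" by (simp add: power_mult_distrib)
    then have "(\<Prod>x\<in>?B. \<bar>t - x\<bar>) \<le> 2 * (\<Prod>x\<in>?B. \<bar>a - x\<bar>)"
      by (rule power2_le_imp_le) (auto intro: prod_nonneg)
    moreover have "0 < (\<Prod>x\<in>?B. \<bar>a - x\<bar>)" using Xp by (intro prod_pos) auto
    ultimately show ?thesis
      by (simp add: poly_lagrange_basis abs_prod abs_divide prod_dividef divide_le_eq)
  qed
  with Xp show ?thesis using that by blast
qed

section \<open>Interpolation of all sign patterns\<close>

definition sign_interpolable :: "nat \<Rightarrow> real \<Rightarrow> real set \<Rightarrow> bool" where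
  "sign_interpolable N K \<Lambda> \<longleftrightarrow> (\<forall>y\<in>\<Lambda> \<rightarrow> {-1, 1}. \<exists>P :: real poly. degree P \<le> N \<and>
     (\<forall>t\<in>{-1..1}. \<bar>poly P t\<bar> \<le> K) \<and> (\<forall>x\<in>\<Lambda>. 1 \<le> y x * poly P x))"

lemma sign_interpolable_pair:
  assumes "sign_interpolable N K \<Lambda>" "x \<in> \<Lambda>" "y \<in> \<Lambda>" "x \<noteq> y"
  obtains P :: "real poly" where "degree P \<le> N" "\<And>t. t \<in> {-1..1} \<Longrightarrow> \<bar>poly P t\<bar> \<le> K"
    "2 \<le> \<bar>poly P x - poly P y\<bar>"
proof -
  have "(\<lambda>z. if z = x then 1 else -1) \<in> \<Lambda> \<rightarrow> {-1, 1::real}" by auto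
  from bspec[OF assms(1)[unfolded sign_interpolable_def] this]
  obtain P :: "real poly" where P: "degree P \<le> N" "\<forall>t\<in>{-1..1}. \<bar>poly P t\<bar> \<le> K"
    "\<forall>z\<in>\<Lambda>. 1 \<le> (if z = x then 1 else -1) * poly P z"
    by blast
  have "1 \<le> poly P x" "1 \<le> - poly P y"
    using P(3)[rule_format, OF assms(2)] P(3)[rule_format, OF assms(3)] assms(4) by auto
  then have "2 \<le> \<bar>poly P x - poly P y\<bar>" by linarith
  with P show ?thesis using that by blast
qed

text \<open>Opposite signs at two nodes force a polynomial to change by at least 2 between them; the
  Lipschitz bound turns this into an angular distance.\<close>

lemma sign_interpolable_separated_arccos:
  assumes "sign_interpolable N K \<Lambda>" "\<Lambda> \<subseteq> {-1..1}" "0 < N" "0 < K"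
  shows "separated (2 / (7 * real N * K)) (arccos ` \<Lambda>)"
  unfolding separated_def
proof (clarify)
  fix x y assume xy: "x \<in> \<Lambda>" "y \<in> \<Lambda>" "arccos x \<noteq> arccos y"
  then obtain P :: "real poly" where P: "degree P \<le> N" "\<And>t. t \<in> {-1..1} \<Longrightarrow> \<bar>poly P t\<bar> \<le> K"
    "2 \<le> \<bar>poly P x - poly P y\<bar>"
    using sign_interpolable_pair[OF assms(1)] by metis
  have "cos (arccos x) = x" "cos (arccos y) = y" using xy assms(2) by (auto intro!: cos_arccos)
  then have "2 \<le> 7 * real N * K * \<bar>arccos x - arccos y\<bar>"
    using poly_cos_Lipschitz[OF P(1,2), of "arccos x" "arccos y"] P(3) by simp
  then show "2 / (7 * real N * K) \<le> \<bar>arccos x - arccos y\<bar>"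
    using assms by (simp add: divide_le_eq mult.commute)
qed

text \<open>The same argument away from the endpoints separates the nodes in the variable x itself,
  in which the kernel sums are estimated.\<close>

lemma sign_interpolable_separated:
  assumes "sign_interpolable N K \<Lambda>" "0 < N" "0 < K" "0 < \<tau>" "\<tau> \<le> pi / 2"
  shows "separated (2 / (7 / sin \<tau> * real N * K)) {x \<in> \<Lambda>. \<bar>x\<bar> \<le> cos \<tau>}"
  unfolding separated_def
proof (clarify)
  fix x y assume xy: "x \<in> \<Lambda>" "y \<in> \<Lambda>" "x \<noteq> y" "\<bar>x\<bar> \<le> cos \<tau>" "\<bar>y\<bar> \<le> cos \<tau>"
  have s: "sin \<tau> > 0" using assms(4,5) pi_gt_zero by (intro sin_gt_zero) linarith+
  obtain P :: "real poly" where P: "degree P \<le> N" "\<And>t. t \<in> {-1..1} \<Longrightarrow> \<bar>poly P t\<bar> \<le> K"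
    "2 \<le> \<bar>poly P x - poly P y\<bar>"
    using sign_interpolable_pair[OF assms(1) xy(1-3)] by metis
  have "2 \<le> 7 / sin \<tau> * real N * K * \<bar>x - y\<bar>"
    using poly_Lipschitz_Icc_cos[OF P(1,2) assms(4,5) xy(4,5)] P(3) by linarith
  moreover have "0 < 7 / sin \<tau> * real N * K" using assms s by simp
  ultimately show "2 / (7 / sin \<tau> * real N * K) \<le> \<bar>x - y\<bar>"
    by (subst pos_divide_le_eq) (auto simp: mult.commute)
qed

text \<open>The two end caps correspond to angles in [0, \<tau>] and [pi - \<tau>, pi]. This serves
  to discard the nodes near the endpoints, where the derivative bound in x degenerates.\<close>

lemma card_near_endpoints_le:
  assumes "finite \<Lambda>" "\<Lambda> \<subseteq> {-1..1}" "separated s (arccos ` \<Lambda>)" "0 < s" "0 < \<tau>" "\<tau> \<le> pi / 2"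
  shows "real (card {x \<in> \<Lambda>. cos \<tau> < \<bar>x\<bar>}) \<le> 2 * (\<tau> / s + 1)"
proof -
  have inj: "inj_on arccos A" if "A \<subseteq> \<Lambda>" for A
    using that assms(2) by (intro inj_on_inverseI[of _ cos]) (force intro: cos_arccos)
  have 1: "real (card {x \<in> \<Lambda>. cos \<tau> < x}) \<le> (\<tau> - 0) / s + 1"
  proof -
    have "arccos ` {x \<in> \<Lambda>. cos \<tau> < x} \<subseteq> {0..\<tau>}"
    proof (rule image_subsetI)
      fix x assume "x \<in> {x \<in> \<Lambda>. cos \<tau> < x}"
      then have x: "x \<in> \<Lambda>" "cos \<tau> < x" by auto
      then have "-1 \<le> x" "x \<le> 1" using assms(2) by auto
      moreover have "arccos x \<le> arccos (cos \<tau>)" using calculation x by (intro arccos_le_arccos) auto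
      ultimately show "arccos x \<in> {0..\<tau>}"
        using assms(5,6) by (auto simp: arccos_lbound arccos_cos)
    qed
    then have "real (card (arccos ` {x \<in> \<Lambda>. cos \<tau> < x})) \<le> (\<tau> - 0) / s + 1"
      using assms by (intro card_separated_Icc_le) (auto intro!: separated_subset[OF assms(3)])
    then show ?thesis using inj by (simp add: card_image)
  qed
  have 2: "real (card {x \<in> \<Lambda>. x < - cos \<tau>}) \<le> (pi - (pi - \<tau>)) / s + 1"
  proof -
    have "arccos ` {x \<in> \<Lambda>. x < - cos \<tau>} \<subseteq> {pi - \<tau>..pi}"
    proof (rule image_subsetI)
      fix x assume "x \<in> {x \<in> \<Lambda>. x < - cos \<tau>}"
      then have x: "x \<in> \<Lambda>" "x < - cos \<tau>" by auto
      then have "-1 \<le> x" "x \<le> 1" using assms(2) by auto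
      moreover have "arccos (- cos \<tau>) \<le> arccos x" using calculation x by (intro arccos_le_arccos) auto
      moreover have "arccos (- cos \<tau>) = pi - \<tau>" using assms(5,6) by (simp add: arccos_minus arccos_cos)
      ultimately show "arccos x \<in> {pi - \<tau>..pi}"
        by (auto simp: arccos_ubound)
    qed
    then have "real (card (arccos ` {x \<in> \<Lambda>. x < - cos \<tau>})) \<le> (pi - (pi - \<tau>)) / s + 1"
      using assms by (intro card_separated_Icc_le) (auto intro!: separated_subset[OF assms(3)])
    then show ?thesis using inj by (simp add: card_image)
  qed
  have "{x \<in> \<Lambda>. cos \<tau> < \<bar>x\<bar>} = {x \<in> \<Lambda>. cos \<tau> < x} \<union> {x \<in> \<Lambda>. x < - cos \<tau>}" by (auto simp: abs_if)
  then have "card {x \<in> \<Lambda>. cos \<tau> < \<bar>x\<bar>} \<le> card {x \<in> \<Lambda>. cos \<tau> < x} + card {x \<in> \<Lambda>. x < - cos \<tau>}"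
    by (simp add: card_Un_le)
  then show ?thesis using 1 2 by simp
qed

text \<open>The upper bound to be set against \<open>sum_inverse_close_pairs_ge\<close>. Bernstein's
  inequality for the localised interpolant yields the term with \<open>card M\<close>; the other
  term is the number of added nodes times the kernel sum over \<open>M\<close> about one of them.
  The subtraction is truncated: nothing is added if \<Lambda> already has at least N + 4p + 1
  nodes.\<close>

lemma sign_interpolable_close_pairs_le:
  fixes N p :: nat and K \<tau> :: real and \<Lambda> :: "real set"
  defines "r \<equiv> 1 / real (2 * p + 1)" and "B \<equiv> 7 / sin \<tau>" and "M \<equiv> {x \<in> \<Lambda>. \<bar>x\<bar> \<le> cos \<tau>}"
  assumes int: "sign_interpolable N K \<Lambda>" and \<Lambda>: "finite \<Lambda>" "\<Lambda> \<subseteq> {-1..1}"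
    and \<tau>: "0 < \<tau>" "\<tau> \<le> pi / 2" and "0 < N" "0 < K"
  shows "(\<Sum>(x, y)\<in>{(x, y) \<in> M \<times> M. x \<noteq> y \<and> \<bar>x - y\<bar> \<le> r}. 1 / \<bar>x - y\<bar>)
    \<le> 4 * (B * real (N + 4 * p) * K *
        (real (card M) + 2 * real (N + 4 * p + 1 - card \<Lambda>) * (10 * r / (2 / (B * real N * K)) + 3)))"
proof -
  let ?J = "\<lambda>u. poly (fejer_poly p) u" and ?N' = "N + 4 * p" and ?Q = "{(x, y) \<in> M \<times> M. x \<noteq> y \<and> \<bar>x - y\<bar> \<le> r}"
  \<comment> \<open>At least N + 4p + 1 nodes make Lagrange interpolation exact for the products
    \<open>H\<close> below; the maximum covers the case that \<Lambda> alone has more.\<close>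
  define n where "n = max (?N' + 1) (card \<Lambda>)"
  obtain X where X: "finite X" "\<Lambda> \<subseteq> X" "X \<subseteq> {-1..1}" "card X = n"
    "\<And>a t. a \<in> X - \<Lambda> \<Longrightarrow> t \<in> {-1..1} \<Longrightarrow> \<bar>poly (lagrange_basis X a) t\<bar> \<le> 2"
    using exists_near_Fekete_extension[OF \<Lambda>, of n] by (auto simp: n_def)
  let ?l = "\<lambda>x k. poly (pderiv (lagrange_basis X x)) k"
  have s: "sin \<tau> > 0" using \<tau> pi_gt_zero by (intro sin_gt_zero) linarith+
  then have B: "B > 0" by (simp add: B_def)
  have M: "finite M" "M \<subseteq> \<Lambda>" "M \<subseteq> {-1..1}" using \<Lambda> by (auto simp: M_def)
  have u2: "\<bar>x - y\<bar> \<le> 2" if "x \<in> X" "y \<in> X" for x y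
  proof -
    have "x \<in> {-1..1}" "y \<in> {-1..1}" using that X by auto
    then show ?thesis by auto
  qed
  have cardA: "card (X - \<Lambda>) = ?N' + 1 - card \<Lambda>"
    using X \<Lambda> by (simp add: card_Diff_subset n_def)
  have upper: "(\<Sum>x\<in>\<Lambda>. ?J (x - k) * \<bar>?l x k\<bar>) \<le> B * real ?N' * K * (1 + 2 * (\<Sum>a\<in>X - \<Lambda>. ?J (k - a)))"
    if k: "k \<in> M" for k
  proof -
    have k1: "k \<in> X" "\<bar>k\<bar> \<le> cos \<tau>" using k M X by (auto simp: M_def)
    \<comment> \<open>These signs align all terms of the Lagrange formula over \<Lambda>, so that it
      controls the sum of absolute values.\<close>
    define y where "y x = (if 0 \<le> ?l x k then 1 else -1 :: real)" for x
    have "y \<in> \<Lambda> \<rightarrow> {-1, 1}" by (auto simp: y_def)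
    with int obtain P :: "real poly" where P: "degree P \<le> N" "\<And>t. t \<in> {-1..1} \<Longrightarrow> \<bar>poly P t\<bar> \<le> K"
      "\<And>x. x \<in> \<Lambda> \<Longrightarrow> 1 \<le> y x * poly P x"
      unfolding sign_interpolable_def by blast
    define H where "H = P * pcompose (fejer_poly p) [:- k, 1:]"
    have Hx: "poly H x = poly P x * ?J (x - k)" for x by (simp add: H_def poly_pcompose)
    have "degree (pcompose (fejer_poly p) [:- k, 1:]) \<le> 4 * p"
      using degree_fejer_poly[of p] by (simp add: degree_pcompose)
    then have degH: "degree H \<le> ?N'"
      unfolding H_def using P(1) by (intro order_trans[OF degree_mult_le]) simp
    have absH: "\<bar>poly H t\<bar> \<le> K" if "t \<in> {-1..1}" for t
    proof -
      have "\<bar>t - k\<bar> \<le> 2" using that subsetD[OF M(3) k] by auto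
      then have "\<bar>poly P t\<bar> * \<bar>?J (t - k)\<bar> \<le> K * 1"
        using P(2)[OF that] \<open>0 < K\<close> poly_fejer_poly_le_1[of "t - k" p]
        by (intro mult_mono) (auto simp: poly_fejer_poly_nonneg)
      then show ?thesis by (simp add: Hx abs_mult)
    qed
    have "(\<Sum>x\<in>\<Lambda>. ?J (x - k) * \<bar>?l x k\<bar>) \<le> (\<Sum>x\<in>\<Lambda>. poly H x * ?l x k)"
    proof (rule sum_mono)
      fix x assume x: "x \<in> \<Lambda>"
      have "\<bar>?l x k\<bar> * 1 \<le> \<bar>?l x k\<bar> * (y x * poly P x)" using P(3)[OF x] by (intro mult_left_mono) auto
      also have "\<dots> = poly P x * ?l x k" by (auto simp: y_def)
      finally have "?J (x - k) * \<bar>?l x k\<bar> \<le> ?J (x - k) * (poly P x * ?l x k)"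
        by (intro mult_left_mono poly_fejer_poly_nonneg) simp
      then show "?J (x - k) * \<bar>?l x k\<bar> \<le> poly H x * ?l x k" by (simp add: Hx mult_ac)
    qed
    also have "\<dots> = poly (pderiv H) k - (\<Sum>a\<in>X - \<Lambda>. poly H a * ?l a k)"
    proof -
      have "poly (pderiv H) k = (\<Sum>x\<in>X. poly H x * ?l x k)"
        using X degH by (intro poly_pderiv_lagrange_interpolation) (auto simp: n_def)
      also have "\<dots> = (\<Sum>a\<in>X - \<Lambda>. poly H a * ?l a k) + (\<Sum>x\<in>\<Lambda>. poly H x * ?l x k)"
        using X by (intro sum.subset_diff) auto
      finally show ?thesis by simp
    qed
    also have "\<dots> \<le> B * real ?N' * K + (\<Sum>a\<in>X - \<Lambda>. K * ?J (k - a) * (B * real ?N' * 2))"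
    proof -
      have "\<bar>poly (pderiv H) k\<bar> \<le> B * real ?N' * K"
        unfolding B_def by (rule poly_deriv_bound_Icc_cos[OF degH absH \<tau> k1(2)])
      moreover have "- (\<Sum>a\<in>X - \<Lambda>. poly H a * ?l a k) \<le> (\<Sum>a\<in>X - \<Lambda>. K * ?J (k - a) * (B * real ?N' * 2))"
        unfolding sum_negf[symmetric]
      proof (rule sum_mono)
        fix a assume a: "a \<in> X - \<Lambda>"
        \<comment> \<open>An added node exists only if \<Lambda> was too small, in which case n = N
          + 4p + 1. Its Lagrange polynomial then has degree at most N + 4p, and Bernstein's
          inequality applies with the bound 2.\<close>
        then have "card \<Lambda> < card X" using X by (intro psubset_card_mono) auto
        then have "n = ?N' + 1" using X(4) by (simp add: n_def)
        then have "degree (lagrange_basis X a) \<le> ?N'"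
          using degree_lagrange_basis_less[OF X(1), of a] a X(4) by simp
        then have l: "\<bar>?l a k\<bar> \<le> B * real ?N' * 2"
          unfolding B_def by (rule poly_deriv_bound_Icc_cos[OF _ X(5)[OF a] \<tau> k1(2)])
        have "a \<in> {-1..1}" using a X by auto
        then have "\<bar>poly H a\<bar> \<le> K * ?J (k - a)"
          using P(2)[of a] poly_fejer_poly_minus[of p "a - k"] poly_fejer_poly_nonneg[of p "k - a"]
          by (simp add: Hx abs_mult mult_right_mono)
        then have "\<bar>poly H a\<bar> * \<bar>?l a k\<bar> \<le> K * ?J (k - a) * (B * real ?N' * 2)"
          using l \<open>0 < K\<close> by (intro mult_mono) (auto simp: poly_fejer_poly_nonneg)
        then show "- (poly H a * ?l a k) \<le> K * ?J (k - a) * (B * real ?N' * 2)"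
          by (simp add: abs_mult[symmetric])
      qed
      ultimately show ?thesis by linarith
    qed
    also have "\<dots> = B * real ?N' * K * (1 + 2 * (\<Sum>a\<in>X - \<Lambda>. ?J (k - a)))"
      by (simp add: sum_distrib_left sum_distrib_right sum.distrib algebra_simps)
    finally show ?thesis .
  qed
  have "(\<Sum>(x, y)\<in>?Q. 1 / \<bar>x - y\<bar>) \<le> (\<Sum>(x, y)\<in>?Q. \<bar>?l x y\<bar>)"
  proof -
    have fin: "finite ?Q" by (rule finite_subset[of _ "M \<times> M"]) (use M in auto)
    \<comment> \<open>The lower bound is for the sum over both orders of a pair; since
      \<open>?Q\<close> is symmetric, that sum is twice the sum over one order.\<close>
    have "(\<Sum>(x, y)\<in>?Q. 2 / \<bar>x - y\<bar>) \<le> (\<Sum>(x, y)\<in>?Q. \<bar>?l x y\<bar> + \<bar>?l y x\<bar>)"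
      using X M by (intro sum_mono) (auto intro!: pderiv_lagrange_basis_add_swap_ge)
    also have "\<dots> = (\<Sum>(x, y)\<in>?Q. \<bar>?l x y\<bar>) + (\<Sum>(x, y)\<in>?Q. \<bar>?l y x\<bar>)"
      by (simp add: case_prod_unfold sum.distrib)
    also have "(\<Sum>(x, y)\<in>?Q. \<bar>?l y x\<bar>) = (\<Sum>(x, y)\<in>?Q. \<bar>?l x y\<bar>)"
      by (rule sum.reindex_bij_witness[of _ "\<lambda>(x, y). (y, x)" "\<lambda>(x, y). (y, x)"])
        (auto simp: abs_minus_commute)
    finally have "(\<Sum>(x, y)\<in>?Q. 2 * (1 / \<bar>x - y\<bar>)) \<le> 2 * (\<Sum>(x, y)\<in>?Q. \<bar>?l x y\<bar>)" by simp
    then show ?thesis by (simp only: case_prod_unfold flip: sum_distrib_left)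
  qed
  also have "\<dots> \<le> (\<Sum>(x, y)\<in>?Q. 4 * (?J (x - y) * \<bar>?l x y\<bar>))"
  proof (rule sum_mono, clarify)
    fix x y assume "\<bar>x - y\<bar> \<le> r"
    then have "1 / 4 \<le> ?J (x - y)" unfolding r_def by (rule poly_fejer_poly_ge)
    then have "1 * \<bar>?l x y\<bar> \<le> (4 * ?J (x - y)) * \<bar>?l x y\<bar>" by (intro mult_right_mono) auto
    then show "\<bar>?l x y\<bar> \<le> 4 * (?J (x - y) * \<bar>?l x y\<bar>)" by simp
  qed
  also have "\<dots> \<le> (\<Sum>(x, y)\<in>\<Lambda> \<times> M. 4 * (?J (x - y) * \<bar>?l x y\<bar>))"
    by (rule sum_mono2) (use M \<Lambda> in \<open>auto simp: poly_fejer_poly_nonneg\<close>)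
  also have "\<dots> = (\<Sum>y\<in>M. \<Sum>x\<in>\<Lambda>. 4 * (?J (x - y) * \<bar>?l x y\<bar>))"
    by (subst sum.swap) (simp add: sum.cartesian_product)
  also have "\<dots> = 4 * (\<Sum>k\<in>M. \<Sum>x\<in>\<Lambda>. ?J (x - k) * \<bar>?l x k\<bar>)"
    by (simp only: sum_distrib_left)
  also have "\<dots> \<le> 4 * (\<Sum>k\<in>M. B * real ?N' * K * (1 + 2 * (\<Sum>a\<in>X - \<Lambda>. ?J (k - a))))"
    using upper by (intro mult_left_mono sum_mono) auto
  \<comment> \<open>Exchanging the sums puts the centre of the kernel at an added node, so that it
    is summed over the separated set \<open>M\<close>.\<close>
  also have "(\<Sum>k\<in>M. B * real ?N' * K * (1 + 2 * (\<Sum>a\<in>X - \<Lambda>. ?J (k - a))))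
      = B * real ?N' * K * (real (card M) + 2 * (\<Sum>a\<in>X - \<Lambda>. \<Sum>k\<in>M. ?J (k - a)))"
    by (subst sum.swap[of _ M]) (simp add: sum_distrib_left[symmetric] sum.distrib)
  also have "4 * \<dots> \<le> 4 * (B * real ?N' * K *
        (real (card M) + 2 * (\<Sum>a\<in>X - \<Lambda>. 10 * r / (2 / (B * real N * K)) + 3)))"
  proof (intro mult_left_mono add_left_mono sum_mono)
    fix a assume a: "a \<in> X - \<Lambda>"
    show "(\<Sum>k\<in>M. ?J (k - a)) \<le> 10 * r / (2 / (B * real N * K)) + 3"
      unfolding r_def
    proof (rule sum_fejer_poly_le[OF M(1)])
      show "separated (2 / (B * real N * K)) M"
        unfolding B_def M_def using assms by (intro sign_interpolable_separated) auto
      show "0 < 2 / (B * real N * K)" using B assms by simp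
      show "\<bar>x - a\<bar> \<le> 2" if "x \<in> M" for x using that a M X by (intro u2) auto
    qed
  qed (use B \<open>0 < K\<close> in auto)
  finally show ?thesis by (simp add: cardA mult.assoc)
qed

text \<open>With M the nodes away from the endpoints, the sum of 1/|x - y| over close pairs is at
  least (I + 1) |M|^2 / 16 and at most c |M|^2, where \<open>c\<close> depends on \<open>K\<close>
  alone. Choosing \<open>I\<close> large makes this contradictory, with \<delta> = 2^-(I +
  6).\<close>

lemma not_sign_interpolable:
  fixes K :: real
  assumes K: "1 \<le> K"
  obtains \<delta> :: real and N\<^sub>0 :: nat where "0 < \<delta>"
    "\<And>N \<Lambda>. N\<^sub>0 \<le> N \<Longrightarrow> finite \<Lambda> \<Longrightarrow> \<Lambda> \<subseteq> {-1..1} \<Longrightarrow> (1 - \<delta>) * real N \<le> real (card \<Lambda>) \<Longrightarrow>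
       \<not> sign_interpolable N K \<Lambda>"
proof -
  \<comment> \<open>At the angular separation 2/(7NK), end caps of this angle hold at most N/4 + 2
    nodes, which leaves at least N/4 away from the endpoints.\<close>
  define \<tau> where "\<tau> = 1 / (28 * K)"
  have "1 / (28 * K) \<le> 1" using K by (simp add: divide_le_eq)
  then have \<tau>: "0 < \<tau>" "\<tau> \<le> pi / 2" using K pi_gt3 unfolding \<tau>_def by (simp, linarith)
  have s: "sin \<tau> > 0" using \<tau> pi_gt_zero by (intro sin_gt_zero) linarith+
  define B where "B = 7 / sin \<tau>"
  have B: "7 \<le> B" using s sin_le_one[of \<tau>] by (simp add: B_def le_divide_eq)
  have BK: "7 \<le> B * K" using mult_mono[OF B K] B by simp
  \<comment> \<open>The factor 32 is 4 * 8, from N + 4p <= 2N <= 8 |M|; 208 is 4 * 52, from using N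
    <= 4 |M| once more.\<close>
  define c where "c = 32 * (B * K) * (1 + 208 * (B * K))"
  obtain I :: nat where I: "16 * c < real (I + 1)"
    using reals_Archimedean2[of "16 * c"] by (metis Suc_eq_plus1 less_Suc_eq of_nat_less_iff order_less_trans)
  have "\<not> sign_interpolable N K \<Lambda>"
    if N: "2 ^ (I + 7) \<le> N" and \<Lambda>: "finite \<Lambda>" "\<Lambda> \<subseteq> {-1..1}"
      and card: "(1 - 1 / 2 ^ (I + 6)) * real N \<le> real (card \<Lambda>)" for N \<Lambda>
  proof
    assume int: "sign_interpolable N K \<Lambda>"
    have N': "2 ^ (I + 7) \<le> real N" using N by (metis of_nat_le_iff of_nat_numeral of_nat_power)
    have "(1::real) \<le> 2 ^ I" by (rule one_le_power) simp
    moreover have "(2::real) ^ (I + 7) = 128 * 2 ^ I" by (simp add: power_add)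
    ultimately have N128: "128 \<le> real N" using N' by linarith
    \<comment> \<open>This is half of the permitted deficiency \<delta> N, and \<open>p\<close> is
      its integer part: the degree of the kernel and the deficiency are of the same order.\<close>
    define e where "e = real N / 2 ^ (I + 7)"
    have e: "1 \<le> e" "e \<le> real N / 128"
      using N' \<open>1 \<le> 2 ^ I\<close> N128 by (simp_all add: e_def power_add field_simps)
    define p where "p = N div 2 ^ (I + 7)"
    have "real p \<le> e" unfolding p_def e_def
      using of_nat_div_le_of_nat[of N "2 ^ (I + 7)", where 'a = real] by simp
    moreover have "e - 1 < real p"
    proof -
      have "N < (p + 1) * 2 ^ (I + 7)"
        unfolding p_def using dividend_less_div_times[of "2 ^ (I + 7)" N] by simp
      then have "real N < real ((p + 1) * 2 ^ (I + 7))" by (simp only: of_nat_less_iff)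
      then show ?thesis by (simp add: e_def divide_less_eq algebra_simps)
    qed
    ultimately have p: "real p \<le> e" "e - 1 < real p" .
    define r where "r = 1 / real (2 * p + 1)"
    have r0: "0 < r" "r \<le> 1" by (auto simp: r_def)
    define M where "M = {x \<in> \<Lambda>. \<bar>x\<bar> \<le> cos \<tau>}"
    define d where "d = real (N + 4 * p + 1 - card \<Lambda>)"
    have card': "real N - 2 * e \<le> real (card \<Lambda>)"
    proof -
      have "(1 - 1 / 2 ^ (I + 6)) * real N = real N - 2 * e" by (simp add: e_def power_add field_simps)
      then show ?thesis using card by simp
    qed
    have N0: "0 < N" using N128 by simp
    have M4: "real N \<le> 4 * real (card M)"
    proof -
      have "real (card {x \<in> \<Lambda>. cos \<tau> < \<bar>x\<bar>}) \<le> 2 * (\<tau> / (2 / (7 * real N * K)) + 1)"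
        using K N0 by (intro card_near_endpoints_le \<Lambda> \<tau> sign_interpolable_separated_arccos[OF int]) auto
      also have "\<dots> = real N / 4 + 2" using K by (simp add: \<tau>_def)
      finally have "real (card {x \<in> \<Lambda>. cos \<tau> < \<bar>x\<bar>}) \<le> real N / 4 + 2" .
      moreover have "card \<Lambda> = card M + card {x \<in> \<Lambda>. cos \<tau> < \<bar>x\<bar>}"
        unfolding M_def using \<Lambda>(1) by (subst card_Un_disjoint[symmetric]) (auto intro!: arg_cong[of _ _ card])
      ultimately show ?thesis using card' e N128 by linarith
    qed
    then have M0: "0 < real (card M)" using N128 by linarith
    have d: "d \<le> 2 * e + 4 * real p + 1" "0 \<le> d"
      using card' e by (auto simp: d_def of_nat_diff_if)
    \<comment> \<open>The number \<open>d\<close> of added nodes is at most of order 1/r. Hence the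
      kernel sums over all added nodes total O(N), uniformly in \<delta>.\<close>
    have rd: "r * d \<le> 4"
    proof -
      have "d \<le> 4 * real (2 * p + 1)" using d p by simp
      then show ?thesis by (simp add: r_def divide_le_eq)
    qed
    have "real (I + 1) * (real (card M))\<^sup>2 / 16
        \<le> (\<Sum>(x, y)\<in>{(x, y) \<in> M \<times> M. x \<noteq> y \<and> \<bar>x - y\<bar> \<le> r}. 1 / \<bar>x - y\<bar>)"
    proof (rule sum_inverse_close_pairs_ge)
      have "8 * 2 ^ I * real (2 * p + 1) \<le> 8 * 2 ^ I * (4 * e)" using p e by (intro mult_left_mono) auto
      also have "\<dots> = real N / 4" by (simp add: e_def power_add)
      also have "\<dots> \<le> real (card M)" using M4 by simp
      finally show "8 * 2 ^ I \<le> r * real (card M)" by (simp add: r_def le_divide_eq)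
    qed (use \<Lambda> r0 in \<open>auto simp: M_def\<close>)
    also have "\<dots> \<le> 4 * (B * real (N + 4 * p) * K *
        (real (card M) + 2 * d * (10 * r / (2 / (B * real N * K)) + 3)))"
      unfolding r_def B_def M_def d_def
      using K N0 by (intro sign_interpolable_close_pairs_le int \<Lambda> \<tau>) auto
    also have "\<dots> \<le> 4 * (B * (2 * (4 * real (card M))) * K * (real (card M) + 208 * (B * K) * real (card M)))"
    proof -
      have "2 * d * (10 * r / (2 / (B * real N * K)) + 3) = 2 * (5 * (B * K) * real N * (r * d) + 3 * d)"
        by (simp add: algebra_simps)
      also have "\<dots> \<le> 2 * (5 * (B * K) * real N * 4 + 3 * (2 * real N))"
        using rd BK d p e by (intro mult_left_mono add_mono) auto
      also have "\<dots> \<le> 52 * (B * K) * real N"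
        using mult_right_mono[of 1 "B * K" "real N"] BK by simp
      also have "\<dots> \<le> 52 * (B * K) * (4 * real (card M))"
        using M4 BK by (intro mult_left_mono) auto
      finally have 1: "2 * d * (10 * r / (2 / (B * real N * K)) + 3) \<le> 208 * (B * K) * real (card M)" by simp
      have "real (N + 4 * p) \<le> 2 * (4 * real (card M))" using p e M4 by simp
      then have 2: "B * real (N + 4 * p) * K \<le> B * (2 * (4 * real (card M))) * K"
        using B K by (intro mult_right_mono mult_left_mono) auto
      then show ?thesis
        using B K d r0 by (intro mult_left_mono[OF mult_mono[OF 2 add_left_mono[OF 1]]]) auto
    qed
    also have "\<dots> = c * (real (card M))\<^sup>2"
      by (simp add: c_def power2_eq_square algebra_simps)
    finally have "real (I + 1) \<le> 16 * c" using M0 by simp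
    then show False using I by simp
  qed
  then show ?thesis using that[of "1 / 2 ^ (I + 6)" "2 ^ (I + 7)"] by simp
qed

section \<open>Localisation\<close>

definition sign_approximable :: "nat \<Rightarrow> real \<Rightarrow> real \<Rightarrow> real set \<Rightarrow> bool" where
  "sign_approximable N C \<rho> U \<longleftrightarrow> (\<forall>y\<in>U \<rightarrow> {-1, 1}. \<exists>P :: real poly. degree P \<le> N \<and>
     (\<forall>t\<in>{-1..1}. \<bar>poly P t\<bar> \<le> C) \<and> (\<forall>x\<in>U. \<bar>poly P x - y x\<bar> \<le> \<rho>))"

text \<open>An error of at most \<rho> leaves y P >= 1 - \<rho>, which is rescaled to 1.\<close>

lemma sign_approximable_imp_interpolable:
  assumes "sign_approximable N C \<rho> U" "\<rho> < 1"
  shows "sign_interpolable N (C / (1 - \<rho>)) U"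
  unfolding sign_interpolable_def
proof
  fix y :: "real \<Rightarrow> real" assume y: "y \<in> U \<rightarrow> {-1, 1}"
  then obtain P :: "real poly" where P: "degree P \<le> N" "\<forall>t\<in>{-1..1}. \<bar>poly P t\<bar> \<le> C"
    "\<forall>x\<in>U. \<bar>poly P x - y x\<bar> \<le> \<rho>"
    using assms(1) unfolding sign_approximable_def by blast
  have "1 \<le> y x * poly P x / (1 - \<rho>)" if "x \<in> U" for x
  proof -
    have "y x = 1 \<or> y x = -1" "\<bar>poly P x - y x\<bar> \<le> \<rho>" using that y P(3) by auto
    then have "1 - \<rho> \<le> y x * poly P x" by auto
    then show ?thesis using assms(2) by simp
  qed
  then show "\<exists>P. degree P \<le> N \<and> (\<forall>t\<in>{-1..1}. \<bar>poly P t\<bar> \<le> C / (1 - \<rho>)) \<and> (\<forall>x\<in>U. 1 \<le> y x * poly P x)"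
    using P(1,2) assms(2)
    by (intro exI[of _ "smult (1 / (1 - \<rho>)) P"]) (auto simp: abs_mult divide_right_mono)
qed

lemma sign_interpolable_mono:
  assumes "sign_interpolable N K \<Lambda>" "K \<le> K'"
  shows "sign_interpolable N K' \<Lambda>"
  using assms unfolding sign_interpolable_def by (meson order_trans)

text \<open>The local approximants at the points c of a grid of spacing r are summed with weights
  J(c - x). At a node the grid point within r contributes at least (1 - \<rho>)/4 with the right
  sign, and the grid points beyond L r spoil at most 8C/(L - 1) <= (1 - \<rho>)/8. The remaining
  margin (1 - \<rho>)/8 is scaled to 1; as the weights sum to at most 13, the bound is 8 * 13 C/(1 -
  \<rho>).\<close>

lemma sign_interpolable_of_local:
  fixes N p :: nat and C \<rho> L :: real and \<Lambda> :: "real set"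
  defines "r \<equiv> 1 / real (2 * p + 1)"
  assumes \<Lambda>: "\<Lambda> \<subseteq> {-1..1}" and "0 < C" "\<rho> < 1" "1 < L" "8 * C / (L - 1) \<le> (1 - \<rho>) / 8"
    and loc: "\<And>c. c \<in> {-1..1} \<Longrightarrow> sign_approximable N C \<rho> {x \<in> \<Lambda>. \<bar>x - c\<bar> \<le> L * r}"
  shows "sign_interpolable (N + 4 * p) (104 * C / (1 - \<rho>)) \<Lambda>"
  unfolding sign_interpolable_def
proof
  fix y :: "real \<Rightarrow> real" assume y: "y \<in> \<Lambda> \<rightarrow> {-1, 1}"
  let ?J = "\<lambda>u. poly (fejer_poly p) u"
  \<comment> \<open>As 1/r is an integer, the multiples of r run exactly from -1 to 1, so every
    point of [-1, 1] is within r of the grid.\<close>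
  define G where "G = (\<lambda>i. real_of_int i * r) ` {- int (2 * p + 1)..int (2 * p + 1)}"
  have r: "r > 0" by (simp add: r_def)
  have G: "finite G" "G \<subseteq> {-1..1}" "separated r G"
  proof -
    show "finite G" by (simp add: G_def)
    have "\<bar>real_of_int i * r\<bar> \<le> 1" if "\<bar>i\<bar> \<le> int (2 * p + 1)" for i
    proof -
      have "\<bar>real_of_int i\<bar> \<le> real (2 * p + 1)" using that by linarith
      then show ?thesis by (simp add: r_def abs_divide divide_le_eq)
    qed
    then show "G \<subseteq> {-1..1}" unfolding G_def by (force simp: abs_le_iff)
    have sep: "r \<le> \<bar>real_of_int i * r - real_of_int j * r\<bar>" if "i \<noteq> j" for i j
    proof -
      have "1 * r \<le> \<bar>real_of_int (i - j)\<bar> * r" using that r by (intro mult_right_mono) linarith+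
      also have "\<dots> = \<bar>real_of_int i * r - real_of_int j * r\<bar>"
        using r by (simp add: abs_mult flip: left_diff_distrib)
      finally show ?thesis by simp
    qed
    show "separated r G"
      unfolding separated_def
    proof (intro ballI impI)
      fix a b assume ab: "a \<in> G" "b \<in> G" "a \<noteq> b"
      then obtain i j where ij: "a = real_of_int i * r" "b = real_of_int j * r" by (auto simp: G_def)
      then have "i \<noteq> j" using ab(3) by auto
      then show "r \<le> \<bar>a - b\<bar>" using sep ij by blast
    qed
  qed
  have le2: "\<bar>c - x\<bar> \<le> 2" if "c \<in> G" "x \<in> {-1..1}" for c x
    using that subsetD[OF G(2)] by force
  have sumJ: "(\<Sum>c\<in>G. ?J (c - x)) \<le> 13" if "x \<in> {-1..1}" for x
  proof -
    have "(\<Sum>c\<in>G. ?J (c - x)) \<le> 10 * r / r + 3"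
      using sum_fejer_poly_le[OF G(1,3) r, of x p] le2[OF _ that] unfolding r_def by blast
    then show ?thesis using r by simp
  qed
  have "\<exists>P :: real poly. degree P \<le> N \<and> (\<forall>t\<in>{-1..1}. \<bar>poly P t\<bar> \<le> C) \<and>
      (\<forall>x\<in>\<Lambda>. \<bar>x - c\<bar> \<le> L * r \<longrightarrow> \<bar>poly P x - y x\<bar> \<le> \<rho>)" if "c \<in> G" for c
  proof -
    have "y \<in> {x \<in> \<Lambda>. \<bar>x - c\<bar> \<le> L * r} \<rightarrow> {-1, 1}" using y by auto
    moreover have "c \<in> {-1..1}" using that G(2) by auto
    ultimately obtain P :: "real poly" where "degree P \<le> N" "\<forall>t\<in>{-1..1}. \<bar>poly P t\<bar> \<le> C"
      "\<forall>x\<in>{x \<in> \<Lambda>. \<bar>x - c\<bar> \<le> L * r}. \<bar>poly P x - y x\<bar> \<le> \<rho>"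
      using loc unfolding sign_approximable_def by blast
    then show ?thesis by (intro exI[of _ P]) auto
  qed
  then obtain P :: "real \<Rightarrow> real poly" where P: "\<And>c. c \<in> G \<Longrightarrow> degree (P c) \<le> N"
    "\<And>c t. c \<in> G \<Longrightarrow> t \<in> {-1..1} \<Longrightarrow> \<bar>poly (P c) t\<bar> \<le> C"
    "\<And>c x. c \<in> G \<Longrightarrow> x \<in> \<Lambda> \<Longrightarrow> \<bar>x - c\<bar> \<le> L * r \<Longrightarrow> \<bar>poly (P c) x - y x\<bar> \<le> \<rho>"
    by metis
  define H where "H = smult (8 / (1 - \<rho>)) (\<Sum>c\<in>G. P c * pcompose (fejer_poly p) [:c, -1:])"
  have Hx: "poly H x = 8 / (1 - \<rho>) * (\<Sum>c\<in>G. poly (P c) x * ?J (c - x))" for x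
    by (simp add: H_def poly_sum poly_pcompose)
  have deg: "degree H \<le> N + 4 * p"
  proof -
    have "degree (pcompose (fejer_poly p) [:c, -1:]) \<le> 4 * p" for c
      using degree_fejer_poly[of p] by (simp add: degree_pcompose)
    then have "degree (\<Sum>c\<in>G. P c * pcompose (fejer_poly p) [:c, -1:]) \<le> N + 4 * p"
      by (intro degree_sum_le G order_trans[OF degree_mult_le] add_mono P)
    then show ?thesis unfolding H_def by (intro order_trans[OF degree_smult_le])
  qed
  have bound: "\<bar>poly H t\<bar> \<le> 104 * C / (1 - \<rho>)" if t: "t \<in> {-1..1}" for t
  proof -
    have "\<bar>\<Sum>c\<in>G. poly (P c) t * ?J (c - t)\<bar> \<le> (\<Sum>c\<in>G. \<bar>poly (P c) t\<bar> * ?J (c - t))"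
      by (rule order_trans[OF sum_abs]) (simp add: abs_mult poly_fejer_poly_nonneg)
    also have "\<dots> \<le> (\<Sum>c\<in>G. C * ?J (c - t))"
      using P(2) t by (intro sum_mono mult_right_mono poly_fejer_poly_nonneg) auto
    also have "\<dots> \<le> C * 13" using sumJ[OF t] \<open>0 < C\<close> by (simp flip: sum_distrib_left)
    finally have "8 / (1 - \<rho>) * \<bar>\<Sum>c\<in>G. poly (P c) t * ?J (c - t)\<bar> \<le> 8 / (1 - \<rho>) * (C * 13)"
      using \<open>\<rho> < 1\<close> by (intro mult_left_mono) auto
    then show ?thesis using \<open>\<rho> < 1\<close> by (simp add: Hx abs_mult)
  qed
  have pos: "1 \<le> y x * poly H x" if x: "x \<in> \<Lambda>" for x
  proof -
    have x1: "x \<in> {-1..1}" using x \<Lambda> by auto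
    have yx: "y x = 1 \<or> y x = -1" using y x by auto
    let ?F = "{c \<in> G. L * r \<le> \<bar>c - x\<bar>}"
    obtain c where c: "c \<in> G" "\<bar>c - x\<bar> \<le> r"
    proof
      let ?i = "\<lfloor>x / r\<rfloor>"
      have "\<bar>x / r\<bar> \<le> real (2 * p + 1)"
        using x1 mult_right_mono[of "\<bar>x\<bar>" 1 "real (2 * p + 1)"] by (auto simp: r_def abs_mult)
      then have "- real_of_int (int (2 * p + 1)) \<le> x / r" "x / r \<le> real_of_int (int (2 * p + 1))"
        by linarith+
      then have "- int (2 * p + 1) \<le> ?i" "?i \<le> int (2 * p + 1)" by linarith+
      then show "real_of_int ?i * r \<in> G" by (auto simp: G_def)
      have "\<bar>real_of_int ?i - x / r\<bar> \<le> 1" using floor_correct[of "x / r"] by linarith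
      then have "\<bar>real_of_int ?i - x / r\<bar> * r \<le> 1 * r" using r by (intro mult_right_mono) auto
      also have "\<bar>real_of_int ?i - x / r\<bar> * r = \<bar>(real_of_int ?i - x / r) * r\<bar>" using r by (simp add: abs_mult)
      also have "(real_of_int ?i - x / r) * r = real_of_int ?i * r - x" using r by (simp add: algebra_simps)
      finally show "\<bar>real_of_int ?i * r - x\<bar> \<le> r" by simp
    qed
    have "r < L * r" using r \<open>1 < L\<close> by simp
    then have cF: "c \<notin> ?F" using c by auto
    have "C * (8 / (L - 1)) \<le> (1 - \<rho>) / 8" using assms(6) by (simp add: mult.commute)
    then have "(1 - \<rho>) / 4 - (1 - \<rho>) / 8 \<le> (1 - \<rho>) / 4 - C * (8 / (L - 1))" by (rule diff_left_mono)
    also have "\<dots> \<le> (1 - \<rho>) * ?J (c - x) - C * (\<Sum>c\<in>?F. ?J (c - x))"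
    proof (intro diff_mono mult_left_mono)
      have "1 / 4 \<le> ?J (c - x)" using c unfolding r_def by (intro poly_fejer_poly_ge)
      then show "(1 - \<rho>) / 4 \<le> (1 - \<rho>) * ?J (c - x)"
        using mult_left_mono[of "1 / 4" "?J (c - x)" "1 - \<rho>"] \<open>\<rho> < 1\<close> by simp
      have "(\<Sum>c\<in>?F. ?J (c - x)) \<le> 8 * r\<^sup>2 / (r * (L * r - r))"
        unfolding r_def using r \<open>r < L * r\<close> G(1,3) le2[OF _ x1]
        by (intro sum_fejer_poly_far_le) (auto simp: r_def intro: separated_subset)
      also have "\<dots> = 8 / (L - 1)"
      proof -
        have "r * (L * r - r) = r\<^sup>2 * (L - 1)" by (simp add: power2_eq_square algebra_simps)
        then show ?thesis using r by simp
      qed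
      finally show "(\<Sum>c\<in>?F. ?J (c - x)) \<le> 8 / (L - 1)" .
    qed (use \<open>0 < C\<close> in auto)
    also have "\<dots> \<le> (\<Sum>c\<in>G - ?F. (1 - \<rho>) * ?J (c - x)) - C * (\<Sum>c\<in>?F. ?J (c - x))"
      using c cF G(1) \<open>\<rho> < 1\<close> by (intro diff_right_mono member_le_sum) (auto simp: poly_fejer_poly_nonneg)
    also have "\<dots> \<le> (\<Sum>c\<in>G - ?F. y x * poly (P c) x * ?J (c - x)) + (\<Sum>c\<in>?F. y x * poly (P c) x * ?J (c - x))"
    proof -
      have "(\<Sum>c\<in>G - ?F. (1 - \<rho>) * ?J (c - x)) \<le> (\<Sum>c\<in>G - ?F. y x * poly (P c) x * ?J (c - x))"
      proof (intro sum_mono mult_right_mono poly_fejer_poly_nonneg)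
        fix c assume "c \<in> G - ?F"
        then have "\<bar>poly (P c) x - y x\<bar> \<le> \<rho>" using x by (intro P(3)) (auto simp: abs_minus_commute)
        then show "1 - \<rho> \<le> y x * poly (P c) x" using yx by auto
      qed
      moreover have "(\<Sum>c\<in>?F. - C * ?J (c - x)) \<le> (\<Sum>c\<in>?F. y x * poly (P c) x * ?J (c - x))"
      proof (intro sum_mono mult_right_mono poly_fejer_poly_nonneg)
        fix c assume "c \<in> ?F"
        then have "\<bar>poly (P c) x\<bar> \<le> C" using x1 by (intro P(2)) auto
        then show "- C \<le> y x * poly (P c) x" using yx by auto
      qed
      ultimately show ?thesis by (simp add: sum_distrib_left sum_negf)
    qed
    also have "\<dots> = (\<Sum>c\<in>G. y x * poly (P c) x * ?J (c - x))"
      using G(1) by (intro sum.subset_diff[symmetric]) auto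
    also have "\<dots> = y x * (\<Sum>c\<in>G. poly (P c) x * ?J (c - x))"
      by (simp add: sum_distrib_left mult.assoc)
    finally have "1 - \<rho> \<le> 8 * (y x * (\<Sum>c\<in>G. poly (P c) x * ?J (c - x)))" by simp
    then show ?thesis using \<open>\<rho> < 1\<close> by (simp add: Hx mult_ac)
  qed
  show "\<exists>P. degree P \<le> N + 4 * p \<and> (\<forall>t\<in>{-1..1}. \<bar>poly P t\<bar> \<le> 104 * C / (1 - \<rho>)) \<and>
      (\<forall>x\<in>\<Lambda>. 1 \<le> y x * poly P x)"
    using deg bound pos by (intro exI[of _ H]) auto
qed

text \<open>If all blocks of at most \<open>b\<close> nodes were approximable, then pairs would show
  that the nodes are separated, so that a window of radius L r holds at most \<open>b\<close> nodes
  away from the endpoints. All such windows being approximable,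
  \<open>sign_interpolable_of_local\<close> would interpolate almost all nodes, against
  \<open>not_sign_interpolable\<close>.\<close>

lemma exists_small_non_sign_approximable:
  fixes C \<rho> :: real
  assumes "0 < C" "\<rho> < 1"
  obtains \<delta> :: real and b n\<^sub>0 :: nat where "0 < \<delta>" "2 \<le> b"
    "\<And>n N \<Lambda>. n\<^sub>0 \<le> n \<Longrightarrow> n \<le> N \<Longrightarrow> real N \<le> (1 + \<delta>) * real n \<Longrightarrow> finite \<Lambda> \<Longrightarrow> \<Lambda> \<subseteq> {-1..1} \<Longrightarrow>
       (1 - \<delta>) * real n \<le> real (card \<Lambda>) \<Longrightarrow> \<exists>U\<subseteq>\<Lambda>. card U \<le> b \<and> \<not> sign_approximable N C \<rho> U"
proof -
  define K where "K = C / (1 - \<rho>)"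
  have K: "0 < K" using assms by (simp add: K_def)
  obtain \<delta>\<^sub>1 N\<^sub>1 where 1: "0 < \<delta>\<^sub>1"
    "\<And>N \<Lambda>. N\<^sub>1 \<le> N \<Longrightarrow> finite \<Lambda> \<Longrightarrow> \<Lambda> \<subseteq> {-1..1} \<Longrightarrow> (1 - \<delta>\<^sub>1) * real N \<le> real (card \<Lambda>) \<Longrightarrow>
       \<not> sign_interpolable N (max 1 (104 * K)) \<Lambda>"
    using not_sign_interpolable[of "max 1 (104 * K)"] by auto
  define d where "d = min 1 \<delta>\<^sub>1"
  have d: "0 < d" "d \<le> 1" "d \<le> \<delta>\<^sub>1" using 1(1) by (auto simp: d_def)
  \<comment> \<open>Chosen so that the end caps cost at most dn/16 + 2 nodes.\<close>
  define \<tau> where "\<tau> = min 1 (d / (224 * K))"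
  have \<tau>: "0 < \<tau>" "\<tau> \<le> pi / 2" using K d pi_gt3 by (auto simp: \<tau>_def)
  have s: "sin \<tau> > 0" using \<tau> pi_gt_zero by (intro sin_gt_zero) linarith+
  \<comment> \<open>This makes 8C/(L - 1) equal to (1 - \<rho>)/8.\<close>
  define L where "L = 1 + 64 * K"
  \<comment> \<open>The ceiling bounds the length of a window divided by the separation. The summand
    2 absorbs the extra point of that count and makes pairs admissible blocks.\<close>
  define b where "b = nat \<lceil>448 * (L * K) / (sin \<tau> * d)\<rceil> + 2"
  define n\<^sub>0 where "n\<^sub>0 = max N\<^sub>1 (nat \<lceil>32 / d\<rceil>)"
  have main: "\<exists>U\<subseteq>\<Lambda>\<^sub>0. card U \<le> b \<and> \<not> sign_approximable N C \<rho> U"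
    if n: "n\<^sub>0 \<le> n" and N: "n \<le> N" "real N \<le> (1 + d / 16) * real n"
      and \<Lambda>\<^sub>0: "finite \<Lambda>\<^sub>0" "\<Lambda>\<^sub>0 \<subseteq> {-1..1}" and card: "(1 - d / 16) * real n \<le> real (card \<Lambda>\<^sub>0)" for n N \<Lambda>\<^sub>0
  proof (rule ccontr)
    assume "\<not> ?thesis"
    then have app: "sign_approximable N C \<rho> U" if "U \<subseteq> \<Lambda>\<^sub>0" "card U \<le> b" for U using that by blast
    have "32 / d \<le> real n" using n by (simp add: n\<^sub>0_def)
    then have dn: "32 \<le> d * real n" using d by (simp add: divide_le_eq mult.commute)
    then have n0: "0 < real n" using d by (metis less_le_trans mult_zero_right not_less of_nat_0_less_iff neq0_conv of_nat_0 zero_less_numeral)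
    have "d * real n \<le> 1 * real n" using d by (intro mult_right_mono) auto
    then have N2: "real N \<le> 2 * real n" using N(2) by (simp add: distrib_right)
    have N0: "0 < N" using n0 N by simp
    have sepa: "separated (2 / (7 * real N * K)) (arccos ` \<Lambda>\<^sub>0)"
      unfolding separated_def
    proof clarify
      fix x y assume xy: "x \<in> \<Lambda>\<^sub>0" "y \<in> \<Lambda>\<^sub>0" "arccos x \<noteq> arccos y"
      have "sign_interpolable N K {x, y}"
        unfolding K_def using xy assms
        by (intro sign_approximable_imp_interpolable app) (auto simp: b_def card_insert_if)
      then have "separated (2 / (7 * real N * K)) (arccos ` {x, y})"
        using xy \<Lambda>\<^sub>0 N0 K by (intro sign_interpolable_separated_arccos) auto
      then show "2 / (7 * real N * K) \<le> \<bar>arccos x - arccos y\<bar>" using xy by (auto simp: separated_def)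
    qed
    define \<Lambda> where "\<Lambda> = {x \<in> \<Lambda>\<^sub>0. \<bar>x\<bar> \<le> cos \<tau>}"
    have \<Lambda>: "finite \<Lambda>" "\<Lambda> \<subseteq> {-1..1}" using \<Lambda>\<^sub>0 by (auto simp: \<Lambda>_def)
    define s where "s = 2 / (7 / sin \<tau> * real N * K)"
    have s0: "0 < s" using s N0 K by (simp add: s_def)
    have sep: "separated s \<Lambda>"
      unfolding separated_def
    proof (intro ballI impI)
      fix x y assume xy: "x \<in> \<Lambda>" "y \<in> \<Lambda>" "x \<noteq> y"
      have "sign_interpolable N K {x, y}"
        unfolding K_def using xy assms
        by (intro sign_approximable_imp_interpolable app) (auto simp: b_def card_insert_if \<Lambda>_def)
      then have "separated s {z \<in> {x, y}. \<bar>z\<bar> \<le> cos \<tau>}"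
        unfolding s_def using \<tau> N0 K by (intro sign_interpolable_separated) auto
      then show "s \<le> \<bar>x - y\<bar>" using xy by (auto simp: separated_def \<Lambda>_def)
    qed
    define p where "p = nat \<lfloor>d * real n / 32\<rfloor>"
    have p: "real p \<le> d * real n / 32" "d * real n / 32 < real p + 1"
      unfolding p_def using dn by linarith+
    define r where "r = 1 / real (2 * p + 1)"
    have r: "r \<le> 32 / (d * real n)"
    proof -
      have "d * real n / 32 \<le> real (2 * p + 1)" using p dn by simp
      then have "1 / real (2 * p + 1) \<le> 1 / (d * real n / 32)" using dn by (intro divide_left_mono) auto
      then show ?thesis by (simp add: r_def)
    qed
    have L: "1 < L" using K by (simp add: L_def)
    \<comment> \<open>Both r and the separation \<open>s\<close> are of order 1/n, so the number of
      nodes in a window is bounded independently of n.\<close>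
    have "sign_approximable N C \<rho> {x \<in> \<Lambda>. \<bar>x - c\<bar> \<le> L * r}" for c
    proof (rule app)
      have "real (card {x \<in> \<Lambda>. \<bar>x - c\<bar> \<le> L * r}) \<le> ((c + L * r) - (c - L * r)) / s + 1"
        using \<Lambda> s0 L by (intro card_separated_Icc_le separated_subset[OF sep]) (auto simp: r_def)
      also have "((c + L * r) - (c - L * r)) / s = r * (7 * (L * K) / sin \<tau> * real N)"
        by (simp add: s_def field_simps)
      also have "\<dots> \<le> (32 / (d * real n)) * (7 * (L * K) / sin \<tau> * (2 * real n))"
        using r N2 L K s dn by (intro mult_mono mult_left_mono) auto
      also have "\<dots> = 448 * (L * K) / (sin \<tau> * d)" using n0 by (simp add: field_simps)
      also have "\<dots> + 1 \<le> real b" unfolding b_def by linarith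
      finally show "card {x \<in> \<Lambda>. \<bar>x - c\<bar> \<le> L * r} \<le> b" by simp
    qed (auto simp: \<Lambda>_def)
    then have "sign_interpolable (N + 4 * p) (104 * C / (1 - \<rho>)) \<Lambda>"
      using assms L \<Lambda> unfolding r_def
      by (intro sign_interpolable_of_local[where L = L]) (auto simp: L_def K_def)
    then have int: "sign_interpolable (N + 4 * p) (max 1 (104 * K)) \<Lambda>"
      by (rule sign_interpolable_mono) (simp add: K_def)
    \<comment> \<open>The budget: the degree is at most n + 3dn/16, of which dn/8 is due to the
      kernel, and at least n - dn/8 - 2 nodes are left. Since dn >= 32, the loss of d times the
      degree exceeds all of this.\<close>
    have "(1 - \<delta>\<^sub>1) * real (N + 4 * p) \<le> real (card \<Lambda>)"
    proof -
      have "real (card {x \<in> \<Lambda>\<^sub>0. cos \<tau> < \<bar>x\<bar>}) \<le> 2 * (\<tau> / (2 / (7 * real N * K)) + 1)"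
        using K N0 by (intro card_near_endpoints_le \<Lambda>\<^sub>0 \<tau> sepa) auto
      also have "\<dots> = 7 * (\<tau> * K) * real N + 2" by (simp add: field_simps)
      also have "\<dots> \<le> 7 * (d / 224) * (2 * real n) + 2"
      proof -
        have "\<tau> * K \<le> d / (224 * K) * K" using K by (intro mult_right_mono) (auto simp: \<tau>_def)
        also have "\<dots> = d / 224" using K by simp
        finally show ?thesis using N2 K d \<tau> by (intro add_right_mono mult_mono mult_left_mono) auto
      qed
      finally have "real (card {x \<in> \<Lambda>\<^sub>0. cos \<tau> < \<bar>x\<bar>}) \<le> d * real n / 16 + 2" by simp
      moreover have "card \<Lambda>\<^sub>0 = card \<Lambda> + card {x \<in> \<Lambda>\<^sub>0. cos \<tau> < \<bar>x\<bar>}"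
        unfolding \<Lambda>_def using \<Lambda>\<^sub>0(1) by (subst card_Un_disjoint[symmetric]) (auto intro!: arg_cong[of _ _ card])
      ultimately have c: "real n - d * real n / 8 - 2 \<le> real (card \<Lambda>)" using card by (simp add: algebra_simps)
      have "(1 - \<delta>\<^sub>1) * real (N + 4 * p) \<le> (1 - d) * real (N + 4 * p)"
        using d by (intro mult_right_mono) auto
      also have "\<dots> \<le> (1 - d) * (real n + 3 * (d * real n) / 16)"
        using d N(2) p by (intro mult_left_mono) (auto simp: algebra_simps)
      also have "\<dots> = real n - d * real n + (1 - d) * (3 * (d * real n) / 16)"
        by (simp add: algebra_simps)
      also have "\<dots> \<le> real n - d * real n + 1 * (3 * (d * real n) / 16)"
        using d by (intro add_left_mono mult_right_mono) auto
      finally show ?thesis using c dn by linarith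
    qed
    moreover have "N\<^sub>1 \<le> N + 4 * p" using n N by (simp add: n\<^sub>0_def)
    ultimately show False using 1(2) \<Lambda> int by blast
  qed
  show ?thesis
    by (rule that[of "d / 16" b n\<^sub>0]) (use d main in \<open>auto simp: b_def\<close>)
qed

section \<open>Random signs\<close>

text \<open>Exponential Markov inequality for 2^-m, where m is the number of matched blocks. This is
  a product of one factor per block, and disjoint blocks are independent; a block of at most
  \<open>b\<close> indices matches with probability at least 2^-b, so its factor has expectation at
  most 1 - 2^-(b + 1).\<close>

lemma prob_few_matches_le:
  fixes \<U> :: "nat set set" and z :: "nat \<Rightarrow> real" and k :: real
  assumes \<U>: "\<Union>\<U> \<subseteq> {1..n}" "disjoint \<U>" "\<And>U. U \<in> \<U> \<Longrightarrow> card U \<le> b"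
    and z: "\<And>i. i \<in> \<Union>\<U> \<Longrightarrow> z i \<in> {-1, 1}"
  shows "measure_pmf.prob (random_signs n) {Y. real (card {U \<in> \<U>. \<forall>i\<in>U. Y i = z i}) \<le> k}
    \<le> 2 powr k * (1 - (1 / 2) ^ (b + 1)) ^ card \<U>"
proof -
  let ?M = "measure_pmf (random_signs n)"
  let ?E = "measure_pmf.expectation (random_signs n)" and ?P = "measure_pmf.prob (random_signs n)"
  have "finite (\<Union>\<U>)" using \<U>(1) by (rule finite_subset) simp
  then have fin\<U>: "finite \<U>" by (rule finite_UnionD)
  have fin: "finite U" if "U \<in> \<U>" for U
    using \<open>finite (\<Union>\<U>)\<close> that by (auto intro: finite_subset)
  define f where "f U Y = (if \<forall>i\<in>U. Y i = z i then 1 / 2 else 1 :: real)" for U and Y :: "nat \<Rightarrow> real"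
  have f01: "0 \<le> f U Y" "f U Y \<le> 1" for U Y by (auto simp: f_def)
  have int: "integrable ?M g" if "\<And>Y. 0 \<le> g Y \<and> g Y \<le> 1" for g :: "(nat \<Rightarrow> real) \<Rightarrow> real"
    using that by (intro measure_pmf.integrable_const_bound[of _ 1]) auto
  have "?E (f U) \<le> 1 - (1 / 2) ^ (b + 1)" if U: "U \<in> \<U>" for U
  proof -
    have "f U = (\<lambda>Y. 1 - 1 / 2 * indicator {Y. \<forall>i\<in>U. Y i = z i} Y)" by (auto simp: f_def fun_eq_iff)
    then have "?E (f U) = ?E (\<lambda>_. 1) - ?E (\<lambda>Y. 1 / 2 * indicator {Y. \<forall>i\<in>U. Y i = z i} Y)"
      by (simp only:) (intro Bochner_Integration.integral_diff int; auto simp: indicator_def)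
    also have "\<dots> = 1 - 1 / 2 * ?P {Y. \<forall>i\<in>U. Y i = z i}" by simp
    also have "{Y. \<forall>i\<in>U. Y i = z i} = Pi {1..n} (\<lambda>i. if i \<in> U then {z i} else UNIV)"
      using \<U>(1) U by (auto simp: Pi_def split: if_splits)
    also have "?P \<dots> = (\<Prod>i\<in>{1..n}. measure_pmf.prob (pmf_of_set {-1, 1}) (if i \<in> U then {z i} else UNIV))"
      unfolding random_signs_def by (rule measure_Pi_pmf_Pi) simp
    also have "\<dots> = (\<Prod>i\<in>{1..n}. if i \<in> U then 1 / 2 else 1)"
    proof (rule prod.cong[OF refl])
      fix i show "measure_pmf.prob (pmf_of_set {-1, 1}) (if i \<in> U then {z i} else UNIV) = (if i \<in> U then 1 / 2 else 1)"
        using z[of i] U by (auto simp: measure_pmf_single indicator_def)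
    qed
    also have "\<dots> = (1 / 2) ^ card U"
    proof -
      have "{1..n} \<inter> U = U" using \<U>(1) U by blast
      then show ?thesis by (subst prod.If_cases) auto
    qed
    also have "1 - 1 / 2 * (1 / 2 :: real) ^ card U \<le> 1 - 1 / 2 * (1 / 2) ^ b"
      using \<U>(3)[OF U] by (intro diff_left_mono mult_left_mono power_decreasing) auto
    finally show ?thesis by simp
  qed
  moreover have "0 \<le> ?E (f U)" for U using f01 by (intro Bochner_Integration.integral_nonneg) auto
  ultimately have "(\<Prod>U\<in>\<U>. ?E (f U)) \<le> (\<Prod>U\<in>\<U>. 1 - (1 / 2) ^ (b + 1))"
    by (intro prod_mono) auto
  moreover have "?E (\<lambda>Y. \<Prod>U\<in>\<U>. f U Y) = (\<Prod>U\<in>\<U>. ?E (f U))"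
  proof (rule prob_space.indep_vars_lebesgue_integral[OF measure_pmf.prob_space_axioms])
    have "prob_space.indep_vars ?M (\<lambda>_. count_space UNIV) (\<lambda>i Y. Y i) {1..n}"
      unfolding random_signs_def by (rule indep_vars_Pi_pmf) simp
    then have "prob_space.indep_vars ?M (\<lambda>U. PiM U (\<lambda>_. count_space UNIV)) (\<lambda>U Y. restrict (\<lambda>i. Y i) U) \<U>"
      using \<U>(1,2) by (intro prob_space.indep_vars_restrict[OF measure_pmf.prob_space_axioms]) (auto simp: disjoint_family_on_def disjoint_def)
    then have "prob_space.indep_vars ?M (\<lambda>_. borel) (\<lambda>U Y. f U (restrict Y U)) \<U>"
    proof (rule prob_space.indep_vars_compose2[OF measure_pmf.prob_space_axioms])
      fix U assume "U \<in> \<U>"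
      then have [simp]: "finite U" by (rule fin)
      show "f U \<in> borel_measurable (PiM U (\<lambda>_. count_space UNIV))"
        unfolding f_def by measurable
    qed
    \<comment> \<open>Independence was obtained for the restrictions to the blocks; each factor
      depends only on the coordinates in its own block.\<close>
    moreover have "f U (restrict Y U) = f U Y" for U Y by (simp add: f_def)
    ultimately show "prob_space.indep_vars ?M (\<lambda>_. borel) f \<U>" by simp
  qed (use fin\<U> f01 in \<open>auto intro!: int\<close>)
  ultimately have E: "?E (\<lambda>Y. \<Prod>U\<in>\<U>. f U Y) \<le> (1 - (1 / 2) ^ (b + 1)) ^ card \<U>" by simp
  have "2 powr (- k) * ?P {Y. real (card {U \<in> \<U>. \<forall>i\<in>U. Y i = z i}) \<le> k}
      = ?E (\<lambda>Y. 2 powr (- k) * indicator {Y. real (card {U \<in> \<U>. \<forall>i\<in>U. Y i = z i}) \<le> k} Y)"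
    by simp
  also have "\<dots> \<le> ?E (\<lambda>Y. \<Prod>U\<in>\<U>. f U Y)"
  proof (rule Bochner_Integration.integral_mono)
    fix Y
    let ?m = "card {U \<in> \<U>. \<forall>i\<in>U. Y i = z i}"
    have "(\<Prod>U\<in>\<U>. f U Y) = (1 / 2) ^ ?m"
      unfolding f_def using fin\<U> by (subst prod.If_cases) (auto simp: Int_def)
    also have "\<dots> = 2 powr (- real ?m)" by (simp add: powr_minus_divide powr_realpow power_one_over)
    finally show "2 powr (- k) * indicator {Y. real (card {U \<in> \<U>. \<forall>i\<in>U. Y i = z i}) \<le> k} Y \<le> (\<Prod>U\<in>\<U>. f U Y)"
      by (auto simp: indicator_def)
  qed (use f01 in \<open>auto intro!: int prod_nonneg prod_le_1 integrable_mult_right\<close>)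
  finally have "2 powr (- k) * ?P {Y. real (card {U \<in> \<U>. \<forall>i\<in>U. Y i = z i}) \<le> k} \<le> (1 - (1 / 2) ^ (b + 1)) ^ card \<U>"
    using E by linarith
  then have "2 powr k * (2 powr (- k) * ?P {Y. real (card {U \<in> \<U>. \<forall>i\<in>U. Y i = z i}) \<le> k})
      \<le> 2 powr k * (1 - (1 / 2) ^ (b + 1)) ^ card \<U>"
    by (rule mult_left_mono) simp
  then show ?thesis by (simp flip: mult.assoc powr_add)
qed

text \<open>At real points the polynomial of real parts takes the real part of the value. The
  targets being real, neither the bound nor the errors grow, which reduces complex polynomials to
  real ones.\<close>

lemma bounded_polys_Re:
  assumes "P \<in> bounded_polys D C" "0 \<le> D"
  shows "degree (map_poly Re P) \<le> nat \<lfloor>D\<rfloor>"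
    and "\<And>t. t \<in> {-1..1} \<Longrightarrow> \<bar>poly (map_poly Re P) t\<bar> \<le> C"
    and "\<And>t y. \<bar>poly (map_poly Re P) t - y\<bar> \<le> cmod (poly P (of_real t) - of_real y)"
proof -
  have eq: "poly (map_poly Re P) t = Re (poly P (of_real t))" for t
    by (induction P) (auto simp: map_poly_pCons)
  have "real (degree P) \<le> D" using assms by (auto simp: bounded_polys_def)
  then have "degree P \<le> nat \<lfloor>D\<rfloor>" by (simp add: le_nat_floor)
  then show "degree (map_poly Re P) \<le> nat \<lfloor>D\<rfloor>"
    by (intro degree_le) (simp add: coeff_map_poly coeff_eq_0)
  show "\<bar>poly (map_poly Re P) t\<bar> \<le> C" if "t \<in> {-1..1}" for t
  proof -
    have "\<bar>poly (map_poly Re P) t\<bar> \<le> cmod (poly P (of_real t))" by (simp add: eq abs_Re_le_cmod)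
    also have "\<dots> \<le> norm_Icc P" using norm_Icc_attained[of P] that by force
    also have "\<dots> \<le> C" using assms by (simp add: bounded_polys_def)
    finally show ?thesis .
  qed
  show "\<bar>poly (map_poly Re P) t - y\<bar> \<le> cmod (poly P (of_real t) - of_real y)" for t y
    using abs_Re_le_cmod[of "poly P (of_real t) - of_real y"] by (simp add: eq)
qed

section \<open>Forbidden sign patterns on disjoint blocks of indices\<close>

definition forbidden_pattern :: "real \<Rightarrow> real \<Rightarrow> real \<Rightarrow> (nat \<Rightarrow> real) \<Rightarrow> nat set \<Rightarrow> (nat \<Rightarrow> real) \<Rightarrow> bool" where
  "forbidden_pattern D C \<rho> x U z \<longleftrightarrow> z \<in> U \<rightarrow> {-1, 1} \<and>
     (\<forall>P\<in>bounded_polys D C. \<exists>i\<in>U. \<rho> < cmod (poly P (complex_of_real (x i)) - complex_of_real (z i)))"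

text \<open>Blocks consist of indices rather than nodes, because nodes may repeat. A repeated node
  with opposite signs is itself a forbidden pattern, as \<rho> < 1; otherwise \<open>x\<close> is
  injective on \<open>I\<close> and the set of nodes supplied by \<open>small\<close> lifts to a
  block of indices.\<close>

lemma exists_forbidden_pattern:
  fixes x :: "nat \<Rightarrow> real"
  assumes I: "finite I" "\<And>i. i \<in> I \<Longrightarrow> x i \<in> {-1..1}" and "0 \<le> D" "\<rho> < 1" "2 \<le> b"
    and small: "card (x ` I) = card I \<Longrightarrow> \<exists>V\<subseteq>x ` I. card V \<le> b \<and> \<not> sign_approximable (nat \<lfloor>D\<rfloor>) C \<rho> V"
  shows "\<exists>U z. U \<subseteq> I \<and> card U \<le> b \<and> forbidden_pattern D C \<rho> x U z"
proof (rule ccontr)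
  assume contr: "\<not> ?thesis"
  have app: "\<exists>P. degree P \<le> nat \<lfloor>D\<rfloor> \<and> (\<forall>t\<in>{-1..1}. \<bar>poly P t\<bar> \<le> C) \<and> (\<forall>i\<in>U. \<bar>poly P (x i) - z i\<bar> \<le> \<rho>)"
    if Uz: "U \<subseteq> I" "card U \<le> b" "z \<in> U \<rightarrow> {-1, 1}" for U z
  proof -
    have "\<not> forbidden_pattern D C \<rho> x U z" using contr Uz by blast
    then obtain P where P: "P \<in> bounded_polys D C"
      "\<And>i. i \<in> U \<Longrightarrow> cmod (poly P (complex_of_real (x i)) - complex_of_real (z i)) \<le> \<rho>"
      using Uz(3) unfolding forbidden_pattern_def by (auto simp: not_less)
    note Re = bounded_polys_Re[OF P(1) \<open>0 \<le> D\<close>]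
    show ?thesis
      using Re(1,2) order_trans[OF Re(3) P(2)] by (intro exI[of _ "map_poly Re P"]) auto
  qed
  have "inj_on x I"
  proof (rule inj_onI, rule ccontr)
    fix i j assume ij: "i \<in> I" "j \<in> I" "x i = x j" "i \<noteq> j"
    have "card {i, j} \<le> b" using \<open>2 \<le> b\<close> by (simp add: card_insert_if)
    then obtain P :: "real poly" where "\<forall>k\<in>{i, j}. \<bar>poly P (x k) - (if k = i then 1 else -1)\<bar> \<le> \<rho>"
      using app[of "{i, j}" "\<lambda>k. if k = i then 1 else -1"] ij by auto
    then show False using ij \<open>\<rho> < 1\<close> by auto
  qed
  then obtain V where V: "V \<subseteq> x ` I" "card V \<le> b" "\<not> sign_approximable (nat \<lfloor>D\<rfloor>) C \<rho> V"
    using small by (auto simp: card_image)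
  obtain U where U: "U \<subseteq> I" "inj_on x U" "V = x ` U"
    using V(1) by (auto simp: subset_image_inj)
  have "sign_approximable (nat \<lfloor>D\<rfloor>) C \<rho> V"
    unfolding sign_approximable_def
  proof
    fix y :: "real \<Rightarrow> real" assume "y \<in> V \<rightarrow> {-1, 1}"
    then have "(\<lambda>i. y (x i)) \<in> U \<rightarrow> {-1, 1}" using U by auto
    moreover have "card U \<le> b" using U V(2) by (simp add: card_image)
    ultimately show "\<exists>P. degree P \<le> nat \<lfloor>D\<rfloor> \<and> (\<forall>t\<in>{-1..1}. \<bar>poly P t\<bar> \<le> C) \<and> (\<forall>x\<in>V. \<bar>poly P x - y x\<bar> \<le> \<rho>)"
      using app[of U "\<lambda>i. y (x i)"] U(1,3) by auto
  qed
  with V(3) show False by simp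
qed

text \<open>Each matched block contains an index at which P errs, and disjoint blocks yield distinct
  indices.\<close>

lemma card_matched_le_err_count:
  assumes "\<Union>\<U> \<subseteq> {1..n}" "disjoint \<U>" "\<And>U. U \<in> \<U> \<Longrightarrow> forbidden_pattern D C \<rho> x U z" "P \<in> bounded_polys D C"
  shows "card {U \<in> \<U>. \<forall>i\<in>U. Y i = z i} \<le> err_count \<rho> n P x Y"
proof -
  let ?E = "{i \<in> {1..n}. cmod (poly P (complex_of_real (x i)) - complex_of_real (Y i)) > \<rho>}"
  let ?S = "{U \<in> \<U>. \<forall>i\<in>U. Y i = z i}"
  have "\<exists>i. i \<in> U \<and> i \<in> ?E" if "U \<in> ?S" for U
  proof -
    have U: "U \<in> \<U>" "\<And>i. i \<in> U \<Longrightarrow> Y i = z i" using that by auto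
    then obtain i where i: "i \<in> U" "\<rho> < cmod (poly P (complex_of_real (x i)) - complex_of_real (z i))"
      using assms(3)[OF U(1)] assms(4) unfolding forbidden_pattern_def by blast
    moreover have "i \<in> {1..n}" using assms(1) U(1) i(1) by blast
    ultimately have "i \<in> ?E" using U(2) by simp
    with i(1) show ?thesis by blast
  qed
  then have "\<forall>U\<in>?S. \<exists>i. i \<in> U \<and> i \<in> ?E" by blast
  from bchoice[OF this] obtain g where g: "\<forall>U\<in>?S. g U \<in> U \<and> g U \<in> ?E" ..
  have "inj_on g ?S"
  proof (rule inj_onI)
    fix U V assume UV: "U \<in> ?S" "V \<in> ?S" "g U = g V"
    then have "g U \<in> U \<inter> V" using g by auto
    then show "U = V" using UV assms(2) by (auto simp: disjoint_def)
  qed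
  moreover have "g ` ?S \<subseteq> ?E" using g by blast
  ultimately show ?thesis unfolding err_count_def by (rule card_inj_on_le) simp
qed

theorem theorem7p1:
  fixes C \<rho> :: real
  assumes "C > 0" and "0 \<le> \<rho>" and "\<rho> < 1"
  shows "\<exists>\<alpha> \<beta> \<gamma> :: real. \<exists>n\<^sub>1 :: nat. \<alpha> > 0 \<and> \<beta> > 0 \<and> \<gamma> > 0 \<and> n\<^sub>1 \<ge> 1 \<and>
    (\<forall>n\<ge>n\<^sub>1. \<forall>x :: nat \<Rightarrow> real. (\<forall>i\<in>{1..n}. x i \<in> {-1..1}) \<longrightarrow>
      measure_pmf.prob (random_signs n)
        {Y. \<forall>P\<in>bounded_polys ((1 + \<alpha>) * real n) C. real (err_count \<rho> n P x Y) > \<beta> * real n}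
      \<ge> 1 - exp (- \<gamma> * real n))"
proof -
  obtain \<delta> b n\<^sub>0 where \<delta>: "0 < \<delta>" "2 \<le> b"
    "\<And>n N \<Lambda>. n\<^sub>0 \<le> n \<Longrightarrow> n \<le> N \<Longrightarrow> real N \<le> (1 + \<delta>) * real n \<Longrightarrow> finite \<Lambda> \<Longrightarrow> \<Lambda> \<subseteq> {-1..1} \<Longrightarrow>
       (1 - \<delta>) * real n \<le> real (card \<Lambda>) \<Longrightarrow> \<exists>U\<subseteq>\<Lambda>. card U \<le> b \<and> \<not> sign_approximable N C \<rho> U"
    using exists_small_non_sign_approximable[OF assms(1,3)] by blast
  \<comment> \<open>Fewer than \<eta> n blocks of size at most \<open>b\<close> cover at most
    \<delta> n indices.\<close>
  define \<eta> where "\<eta> = \<delta> / real b"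
  \<comment> \<open>With q = 2^-(b + 1) this is 2 \<beta> = \<eta> q. Half of the exponent 2 \<beta>
    n compensates the factor \<open>2 powr (\<beta> * real n)\<close> of the tail bound; the other
    half remains, so that \<gamma> can be taken equal to \<beta>.\<close>
  define \<beta> where "\<beta> = \<eta> * (1 / 2) ^ (b + 2)"
  have pos: "0 < \<eta>" "0 < \<beta>" using \<delta> by (auto simp: \<eta>_def \<beta>_def)
  have main: "1 - exp (- \<beta> * real n) \<le> measure_pmf.prob (random_signs n)
        {Y. \<forall>P\<in>bounded_polys ((1 + \<delta>) * real n) C. real (err_count \<rho> n P x Y) > \<beta> * real n}"
    if n: "max 1 n\<^sub>0 \<le> n" and x: "\<forall>i\<in>{1..n}. x i \<in> {-1..1}" for n and x :: "nat \<Rightarrow> real"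
  proof -
    let ?D = "(1 + \<delta>) * real n"
    have D0: "0 \<le> ?D" using \<delta> by simp
    define S where "S = {\<U>. \<Union>\<U> \<subseteq> {1..n} \<and> disjoint \<U> \<and>
      (\<forall>U\<in>\<U>. card U \<le> b \<and> (\<exists>z. forbidden_pattern ?D C \<rho> x U z))}"
    have "S \<subseteq> Pow (Pow {1..n})" by (auto simp: S_def)
    then have "finite S" by (rule finite_subset) simp
    moreover have "{} \<in> S" by (simp add: S_def)
    ultimately obtain \<U> where \<U>: "\<U> \<in> S" "\<And>\<V>. \<V> \<in> S \<Longrightarrow> \<U> \<subseteq> \<V> \<Longrightarrow> \<U> = \<V>"
      using finite_has_maximal[of S] by blast
    then have \<U>': "\<Union>\<U> \<subseteq> {1..n}" "disjoint \<U>" "\<And>U. U \<in> \<U> \<Longrightarrow> card U \<le> b"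
      "\<And>U. U \<in> \<U> \<Longrightarrow> \<exists>z. forbidden_pattern ?D C \<rho> x U z" by (auto simp: S_def)
    \<comment> \<open>By maximality: at least (1 - \<delta>) n indices lie outside a smaller family,
      and they would contain one more block.\<close>
    have large: "\<eta> * real n \<le> real (card \<U>)"
    proof (rule ccontr)
      assume few: "\<not> ?thesis"
      let ?I = "{1..n} - \<Union>\<U>"
      have "\<exists>V\<subseteq>x ` ?I. card V \<le> b \<and> \<not> sign_approximable (nat \<lfloor>?D\<rfloor>) C \<rho> V" if "card (x ` ?I) = card ?I"
      proof (rule \<delta>(3))
        have "0 \<le> \<delta> * real n" using \<delta>(1) by simp
        then have "int n \<le> \<lfloor>?D\<rfloor>" by (simp add: le_floor_iff distrib_right)
        then show "n \<le> nat \<lfloor>?D\<rfloor>" by simp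
        show "real (nat \<lfloor>?D\<rfloor>) \<le> ?D" using D0 by (simp add: of_nat_nat)
        have "card (\<Union>\<U>) \<le> (\<Sum>U\<in>\<U>. card U)" by (rule card_Union_le_sum_card)
        also have "\<dots> \<le> card \<U> * b" using \<U>'(3) sum_bounded_above[of \<U> card b] by simp
        finally have "real (card (\<Union>\<U>)) \<le> real (card \<U>) * real b" by (simp flip: of_nat_mult)
        also have "\<dots> \<le> \<eta> * real n * real b" using few by (intro mult_right_mono) auto
        also have "\<dots> = \<delta> * real n" using \<delta>(2) by (simp add: \<eta>_def)
        finally have "real (card (\<Union>\<U>)) \<le> \<delta> * real n" .
        moreover have "card ?I = n - card (\<Union>\<U>)" "card (\<Union>\<U>) \<le> n"
          using \<U>'(1) card_mono[OF _ \<U>'(1)] by (auto simp: card_Diff_subset finite_subset)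
        ultimately show "(1 - \<delta>) * real n \<le> real (card (x ` ?I))"
          using that by (simp add: of_nat_diff algebra_simps)
      qed (use n x in auto)
      then obtain U z where U: "U \<subseteq> ?I" "card U \<le> b" "forbidden_pattern ?D C \<rho> x U z"
        using exists_forbidden_pattern[of ?I x ?D \<rho> b C] x D0 assms(3) \<delta>(2) by auto
      have "insert U \<U> \<in> S" using U \<U>' unfolding S_def by (auto simp: disjoint_def)
      then have "U \<in> \<U>" using \<U>(2)[of "insert U \<U>"] by blast
      \<comment> \<open>A block that belongs to the family and avoids its union is empty. No pattern
        is forbidden on the empty block, because an admissible polynomial exists, namely 0.\<close>
      then have "U = {}" using U(1) by blast
      moreover have "0 \<in> bounded_polys ?D C"
        using assms(1) by (simp add: bounded_polys_def norm_Icc_def)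
      ultimately show False using U(3) by (auto simp: forbidden_pattern_def)
    qed
    obtain zz where zz: "\<And>U. U \<in> \<U> \<Longrightarrow> forbidden_pattern ?D C \<rho> x U (zz U)" using \<U>'(4) by metis
    \<comment> \<open>As the blocks are disjoint, their patterns combine into a single vector, which
      is the form that \<open>prob_few_matches_le\<close> requires.\<close>
    define z where "z i = zz (THE U. U \<in> \<U> \<and> i \<in> U) i" for i
    have z: "z i = zz U i" if "U \<in> \<U>" "i \<in> U" for U i
    proof -
      have "(THE U. U \<in> \<U> \<and> i \<in> U) = U"
        using that \<U>'(2) by (intro the_equality) (auto simp: disjoint_def)
      then show ?thesis by (simp add: z_def)
    qed
    have forb: "forbidden_pattern ?D C \<rho> x U z" if "U \<in> \<U>" for U
      using zz[OF that] z[OF that] by (auto simp: forbidden_pattern_def Pi_iff)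
    let ?bad = "{Y. real (card {U \<in> \<U>. \<forall>i\<in>U. Y i = z i}) \<le> \<beta> * real n}"
    let ?q = "(1 / 2 :: real) ^ (b + 1)"
    have "measure_pmf.prob (random_signs n) ?bad \<le> 2 powr (\<beta> * real n) * (1 - ?q) ^ card \<U>"
      using \<U>'(1-3) forb by (intro prob_few_matches_le) (auto simp: forbidden_pattern_def)
    also have "\<dots> \<le> exp (\<beta> * real n) * exp (- (2 * \<beta> * real n))"
    proof (rule mult_mono)
      have "2 powr (\<beta> * real n) = exp (\<beta> * real n * ln 2)" by (simp add: powr_def)
      also have "\<dots> \<le> exp (\<beta> * real n * 1)"
        using pos ln_2_less_1 by (simp add: mult_left_le)
      finally show "2 powr (\<beta> * real n) \<le> exp (\<beta> * real n)" by simp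
      have q: "0 < ?q" "?q \<le> 1" by (simp, rule power_le_one, auto)
      have "(1 - ?q) ^ card \<U> \<le> exp (- ?q) ^ card \<U>"
        using q exp_ge_add_one_self[of "- ?q"] by (intro power_mono) auto
      also have "\<dots> = exp (- ?q * real (card \<U>))" by (simp add: mult.commute flip: exp_of_nat_mult)
      also have "\<dots> \<le> exp (- ?q * (\<eta> * real n))"
        using large q by (simp add: mult_left_mono)
      also have "- ?q * (\<eta> * real n) = - (2 * \<beta> * real n)" by (simp add: \<beta>_def)
      finally show "(1 - ?q) ^ card \<U> \<le> exp (- (2 * \<beta> * real n))" .
      show "0 \<le> (1 - ?q) ^ card \<U>" using q by (intro zero_le_power) simp
    qed auto
    also have "\<dots> = exp (- \<beta> * real n)" by (simp flip: exp_add)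
    finally have bad: "measure_pmf.prob (random_signs n) ?bad \<le> exp (- \<beta> * real n)" .
    have "1 - exp (- \<beta> * real n) \<le> 1 - measure_pmf.prob (random_signs n) ?bad" using bad by simp
    also have "\<dots> = measure_pmf.prob (random_signs n) (- ?bad)"
      using measure_pmf.prob_compl[of ?bad "random_signs n"] by (simp add: Compl_eq_Diff_UNIV)
    also have "\<dots> \<le> measure_pmf.prob (random_signs n)
        {Y. \<forall>P\<in>bounded_polys ?D C. real (err_count \<rho> n P x Y) > \<beta> * real n}"
    proof (rule measure_pmf.finite_measure_mono, clarsimp simp: not_le)
      fix Y P assume "\<beta> * real n < real (card {U \<in> \<U>. \<forall>i\<in>U. Y i = z i})" "P \<in> bounded_polys ?D C"
      then show "\<beta> * real n < real (err_count \<rho> n P x Y)"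
        using card_matched_le_err_count[OF \<U>'(1,2) forb, of P Y] by linarith
    qed simp
    finally show ?thesis .
  qed
  show ?thesis
    by (rule exI[of _ \<delta>], rule exI[of _ \<beta>], rule exI[of _ \<beta>], rule exI[of _ "max 1 n\<^sub>0"])
      (use \<delta> pos main in auto)
qed

end
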